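(* Let $M$ be a perfect matroid design of rank $k$ on a ground set $E$ of size $n$, and let $\ell(M)$ denote the number of loops of $M$. Then $$\widehat{\rho}(I(M))=\frac{\alpha(I(M))}{\widehat{\alpha}(I(M))}=\frac{k\,\alpha(I_{\Delta(M^* )})}{n-\ell(M)}=\frac{\alpha(I_{\Delta(M^* )})}{\widehat{\alpha}(I_{\Delta(M^* )})}=\widehat{\rho}(I_{\Delta(M^* )}).$$
   Context: Let $\mathbb{K}$ be a field, $S=\mathbb{K}[x_e : e\in E]$ the standard graded polynomial ring, and $x^U=\prod_{i\in U}x_i$ for $U\subseteq E$. For a squarefree monomial ideal $I\subseteq S$ and $s\ge 1$, the $s$-th symbolic power is $I^{(s)}=\bigcap_{P\in \mathrm{Min}(I)}P^s$, where $\mathrm{Min}(I)$ is the set of minimal primes of $I$. For a nonzero homogeneous ideal $I$, $\alpha(I)$ is the smallest degree of a nonzero homogeneous element of $I$; the Waldschmidt constant is $\widehat{\alpha}(I)=\lim_{s\to\infty}\alpha(I^{(s)})/s$. The asymptotic resurgence is $\widehat{\rho}(I)=\sup\{ s/r : s,r \text{ positive integers and } I^{(st)}\not\subseteq I^{rt}\text{ for all } t\gg 0\}$. For a matroid $M$ on $E$ with set of bases $\mathcal{B}(M)$ and set of circuits $\mathcal{C}(M)$, the facet ideal is $I(M)=\langle x^B : B\in\mathcal{B}(M)\rangle$, and the Stanley-Reisner ideal (of the independence complex $\Delta(M)$) is $I_{\Delta(M)}=\langle x^C : C\in\mathcal{C}(M)\rangle$. The dual matroid $M^*$ has bases $\{E\setminus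 B : B\in\mathcal{B}(M)\}$. A loop of $M$ is an element contained in no basis. A perfect matroid design is a matroid $M$ such that, for each $1\le r\le \mathrm{rk}(M)$, all flats of rank $r$ have the same cardinality. Standing assumptions: $1\le k<n$. *)

theory Defs
  imports
    Complex_Main
    "HOL-Library.Poly_Mapping"
    "HOL-Algebra.Ideal_Product"
begin

section \<open>Matroids\<close>

text \<open>A matroid is a ground set together with its family of bases; the record only carries
  the data, the axioms are the predicate \<open>matroid\<close>.\<close>

record 'e base_system =
  ground :: "'e set"
  bases :: "'e set set"

definition matroid :: "'e base_system \<Rightarrow> bool" where
  "matroid M \<longleftrightarrow>
     finite (ground M) \<and> bases M \<noteq> {} \<and> (\<forall>B\<in>bases M. B \<subseteq> ground M) \<and>
     (\<forall>A\<in>bases M. \<forall>B\<in>bases M. \<forall>x\<in>A - B. \<exists>y\<in>B - A. insert y (A - {x}) \<in> bases M)"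

definition dual :: "'e base_system \<Rightarrow> 'e base_system" where
  "dual M = \<lparr>ground = ground M, bases = (\<lambda>B. ground M - B) ` bases M\<rparr>"

definition indep :: "'e base_system \<Rightarrow> 'e set \<Rightarrow> bool" where
  "indep M X \<longleftrightarrow> (\<exists>B\<in>bases M. X \<subseteq> B)"

definition circuits :: "'e base_system \<Rightarrow> 'e set set" where
  "circuits M = {C. C \<subseteq> ground M \<and> \<not> indep M C \<and> (\<forall>D. D \<subset> C \<longrightarrow> indep M D)}"

definition loops :: "'e base_system \<Rightarrow> 'e set" where
  "loops M = {e \<in> ground M. \<forall>B\<in>bases M. e \<notin> B}"

definition rank_of :: "'e base_system \<Rightarrow> 'e set \<Rightarrow> nat" where
  "rank_of M X = Max (card ` {I. I \<subseteq> X \<and> indep M I})"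

abbreviation rk :: "'e base_system \<Rightarrow> nat" where
  "rk M \<equiv> rank_of M (ground M)"

definition flat :: "'e base_system \<Rightarrow> 'e set \<Rightarrow> bool" where
  "flat M F \<longleftrightarrow> F \<subseteq> ground M \<and> (\<forall>e\<in>ground M - F. rank_of M F < rank_of M (insert e F))"

definition perfect_matroid_design :: "'e base_system \<Rightarrow> bool" where
  "perfect_matroid_design M \<longleftrightarrow> matroid M \<and>
     (\<forall>r\<in>{1..rk M}. \<forall>F G. flat M F \<and> flat M G \<and> rank_of M F = r \<and> rank_of M G = r
        \<longrightarrow> card F = card G)"


section \<open>Polynomial rings\<close>

text \<open>A monomial is a finitely supported exponent vector and a polynomial is a finitely supported
  family of coefficients indexed by monomials. The type allows all elements of \<^typ>\<open>'e\<close> as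
  variables; the carrier of \<open>poly_ring E\<close> consists of the polynomials in the variables from
  \<open>E\<close> only.\<close>

type_synonym ('e, 'k) mpoly = "('e \<Rightarrow>\<^sub>0 nat) \<Rightarrow>\<^sub>0 'k"

definition poly_ring :: "'e set \<Rightarrow> ('e, 'k::field) mpoly ring" where
  "poly_ring E =
     \<lparr>carrier = {p. \<forall>m\<in>Poly_Mapping.keys p. Poly_Mapping.keys m \<subseteq> E},
      monoid.mult = (*), one = 1, ring.zero = 0, add = (+)\<rparr>"

definition var :: "'e \<Rightarrow> ('e, 'k::field) mpoly" where
  "var i = Poly_Mapping.single (Poly_Mapping.single i 1) 1"

definition sqfree_monom :: "'e set \<Rightarrow> ('e, 'k::field) mpoly" where
  "sqfree_monom U = (\<Prod>i\<in>U. var i)"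

definition monom_degree :: "('e \<Rightarrow>\<^sub>0 nat) \<Rightarrow> nat" where
  "monom_degree m = (\<Sum>i\<in>Poly_Mapping.keys m. Poly_Mapping.lookup m i)"

definition homogeneous :: "nat \<Rightarrow> ('e, 'k::field) mpoly \<Rightarrow> bool" where
  "homogeneous d p \<longleftrightarrow> (\<forall>m\<in>Poly_Mapping.keys p. monom_degree m = d)"

lemma cring_poly_ring: "cring (poly_ring E :: ('e, 'k::field) mpoly ring)"
proof -
  let ?R = "poly_ring E :: ('e, 'k) mpoly ring"
  let ?C = "{p :: ('e, 'k) mpoly. \<forall>m\<in>Poly_Mapping.keys p. Poly_Mapping.keys m \<subseteq> E}"
  have [simp]: "carrier ?R = ?C" "\<And>p q. p \<otimes>\<^bsub>?R\<^esub> q = p * q" "\<And>p q. p \<oplus>\<^bsub>?R\<^esub> q = p + q"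
    "\<one>\<^bsub>?R\<^esub> = 1" "\<zero>\<^bsub>?R\<^esub> = 0"
    by (simp_all add: poly_ring_def)
  have add: "p + q \<in> ?C" if "p \<in> ?C" "q \<in> ?C" for p q
    using that Poly_Mapping.keys_add[of p q] by blast
  have mult: "p * q \<in> ?C" if pq: "p \<in> ?C" "q \<in> ?C" for p q
  proof safe
    fix m i assume m: "m \<in> Poly_Mapping.keys (p * q)" and i: "i \<in> Poly_Mapping.keys m"
    obtain a b where ab: "m = a + b" "a \<in> Poly_Mapping.keys p" "b \<in> Poly_Mapping.keys q"
      using m keys_mult[of p q] by blast
    show "i \<in> E"
      using i ab pq Poly_Mapping.keys_add[of a b] by blast
  qed
  have neg: "- p \<in> ?C" if "p \<in> ?C" for p
    using that by simp
  show ?thesis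
  proof (rule cringI)
    show "abelian_group ?R"
    proof (rule abelian_groupI)
      fix p assume p: "p \<in> carrier ?R"
      then have "- p \<in> carrier ?R" using neg by simp
      moreover have "- p \<oplus>\<^bsub>?R\<^esub> p = \<zero>\<^bsub>?R\<^esub>" by simp
      ultimately show "\<exists>q\<in>carrier ?R. q \<oplus>\<^bsub>?R\<^esub> p = \<zero>\<^bsub>?R\<^esub>" by blast
    next
      fix p q assume "p \<in> carrier ?R" "q \<in> carrier ?R"
      then show "p \<oplus>\<^bsub>?R\<^esub> q \<in> carrier ?R" using add[of p q] by simp
    qed (simp_all add: add.assoc add.commute)
    show "comm_monoid ?R"
    proof (rule comm_monoidI)
      fix p q assume "p \<in> carrier ?R" "q \<in> carrier ?R"
      then show "p \<otimes>\<^bsub>?R\<^esub> q \<in> carrier ?R" using mult[of p q] by simp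
    qed (simp_all add: mult.assoc mult.commute)
  qed (simp add: distrib_right)
qed


section \<open>Invariants of ideals\<close>

text \<open>Powers of ideals are powers in the library's semiring \<open>ideals_set R\<close> of ideals of \<open>R\<close>,
  whose multiplication is the product of ideals and whose unit is \<open>R\<close> itself.\<close>

abbreviation ideal_power :: "'a ring \<Rightarrow> 'a set \<Rightarrow> nat \<Rightarrow> 'a set" where
  "ideal_power R I s \<equiv> I [^]\<^bsub>ideals_set R\<^esub> s"

definition minimal_primes :: "'a ring \<Rightarrow> 'a set \<Rightarrow> 'a set set" where
  "minimal_primes R I = {P. primeideal P R \<and> I \<subseteq> P \<and>
     (\<forall>Q. primeideal Q R \<and> I \<subseteq> Q \<and> Q \<subseteq> P \<longrightarrow> Q = P)}"

text \<open>The intersection with the carrier only matters for the unit ideal, which has no minimal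
  primes.\<close>

definition symbolic_power :: "'a ring \<Rightarrow> 'a set \<Rightarrow> nat \<Rightarrow> 'a set" where
  "symbolic_power R I s = carrier R \<inter> (\<Inter>P\<in>minimal_primes R I. ideal_power R P s)"

definition initial_degree :: "('e, 'k::field) mpoly set \<Rightarrow> nat" where
  "initial_degree I = (LEAST d. \<exists>p\<in>I. p \<noteq> 0 \<and> homogeneous d p)"

definition waldschmidt :: "('e, 'k::field) mpoly ring \<Rightarrow> ('e, 'k) mpoly set \<Rightarrow> real" where
  "waldschmidt S I = lim (\<lambda>s. real (initial_degree (symbolic_power S I s)) / real s)"

text \<open>For a proper nonzero squarefree monomial ideal the set below is nonempty and bounded above,
  so the supremum may be taken in the reals.\<close>

definition asymptotic_resurgence :: "'a ring \<Rightarrow> 'a set \<Rightarrow> real" where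
  "asymptotic_resurgence S I =
     Sup {real s / real r | s r. 0 < s \<and> 0 < r \<and>
       (\<forall>\<^sub>F t in sequentially. \<not> symbolic_power S I (s * t) \<subseteq> ideal_power S I (r * t))}"


section \<open>Ideals of a matroid\<close>

definition facet_ideal :: "('e, 'k::field) mpoly ring \<Rightarrow> 'e base_system \<Rightarrow> ('e, 'k) mpoly set" where
  "facet_ideal S M = Idl\<^bsub>S\<^esub> (sqfree_monom ` bases M)"

definition stanley_reisner_ideal ::
  "('e, 'k::field) mpoly ring \<Rightarrow> 'e base_system \<Rightarrow> ('e, 'k) mpoly set" where
  "stanley_reisner_ideal S M = Idl\<^bsub>S\<^esub> (sqfree_monom ` circuits M)"

end

theory Submission
  imports Defs
begin

text \<open>Write \<open>d\<close> for the common size of the cocircuits, i.e. of the circuits of the dual matroid. These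
  are the minimal sets meeting every basis and, conversely, the bases are the minimal sets meeting
  every cocircuit; so the symbolic powers of each of the two ideals consist of the monomials \<open>x\<^sup>a\<close>
  with \<open>a(T) \<ge> s\<close> for all generating sets \<open>T\<close> of the other one. Everything follows from a single
  inequality, symmetric in \<open>w\<close> and \<open>y\<close>: if \<open>w, y \<ge> 0\<close>, \<open>w(B) \<ge> u\<close> for all bases and \<open>y(C) \<ge> v\<close> for
  all cocircuits, then \<open>u v (n - \<ell>) \<le> k d \<Sum> w\<^sub>e y\<^sub>e\<close>. Taking one of the functions constant gives
  the Waldschmidt constants \<open>(n - \<ell>) / d\<close> and \<open>(n - \<ell>) / k\<close>. In general it says that an exponent in a
  symbolic power dominates a fractional packing of generators of the expected size, which bounds the
  asymptotic resurgence from above. The inequality itself is obtained by averaging \<open>y\<close> over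
  the covers of a flat, which in a perfect matroid design are equally large, and by running the
  greedy algorithm for \<open>w\<close>.\<close>

section \<open>Transversals and closures in matroids\<close>

text \<open>The indicator of the nonloops makes the inequality an equality with \<open>u = k\<close>
  and \<open>v = d\<close>; this is where the constant \<open>k d / (n - \<ell>)\<close> comes from,
  and constant exponents on the nonloops are accordingly the witnesses that bound the Waldschmidt
  constants from above and the resurgence from below. A greedy step lowers \<open>w\<close>
  uniformly outside a flat of rank \<open>i\<close>. It trades \<open>k - i\<close> units of basis
  weight against the \<open>y\<close>-weight of the complement, so that weight has to be large
  enough: averaging shows that it is at least proportional to the size of the complement, and
  counting covers shows that the complement contains at least the share \<open>(k - i) / k\<close>
  of all nonloops. Both arguments rely on complements of flats of equal rank being equally large.
  For an exponent in a symbolic power the inequality says that every weight function has a cheap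
  generator. This is the dual form of a fractional packing. Rounding the packing loses at most one
  unit per generator, a loss that does not grow with \<open>t\<close>, so that every strict gap
  between \<open>s / r\<close> and the constant decides the containment for large
  \<open>t\<close>.\<close>

definition transversal :: "'a set set \<Rightarrow> 'a set \<Rightarrow> bool" where
  "transversal H T \<longleftrightarrow> (\<forall>B\<in>H. B \<inter> T \<noteq> {})"

definition min_transversals :: "'a set \<Rightarrow> 'a set set \<Rightarrow> 'a set set" where
  "min_transversals E H =
     {T. T \<subseteq> E \<and> transversal H T \<and> (\<forall>T'. T' \<subset> T \<longrightarrow> \<not> transversal H T')}"

lemma min_transversal_exists:
  assumes "finite T" "T \<subseteq> E" "transversal H T"
  shows "\<exists>T'\<in>min_transversals E H. T' \<subseteq> T"
  using assms
proof (induction T rule: finite_psubset_induct)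
  case (psubset T)
  show ?case
  proof (cases "\<exists>T'. T' \<subset> T \<and> transversal H T'")
    case True
    then obtain T' where "T' \<subset> T" "transversal H T'" by blast
    then show ?thesis using psubset.IH[of T'] psubset.prems by blast
  next
    case False
    then show ?thesis using psubset.prems by (auto simp: min_transversals_def)
  qed
qed

text \<open>The blocker of the blocker is the original clutter: if \<open>T\<close> meets all blocking sets but contains
  no member of \<open>H\<close>, then its complement blocks \<open>H\<close>.\<close>

lemma min_transversals_involution:
  assumes "finite E" "\<And>B. B \<in> H \<Longrightarrow> B \<subseteq> E" "\<And>A B. A \<in> H \<Longrightarrow> B \<in> H \<Longrightarrow> A \<subseteq> B \<Longrightarrow> A = B"
  shows "min_transversals E (min_transversals E H) = H"
proof -
  let ?C = "min_transversals E H"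
  have tr: "transversal ?C B" if "B \<in> H" for B
    using that by (auto simp: min_transversals_def transversal_def)
  have contains: "\<exists>B\<in>H. B \<subseteq> T" if T: "transversal ?C T" for T
  proof (rule ccontr)
    assume neg: "\<not> (\<exists>B\<in>H. B \<subseteq> T)"
    have "transversal H (E - T)"
      unfolding transversal_def
    proof
      fix B assume "B \<in> H"
      then show "B \<inter> (E - T) \<noteq> {}" using neg assms(2)[of B] by blast
    qed
    then obtain C where "C \<in> ?C" "C \<subseteq> E - T"
      using min_transversal_exists[of "E - T" E H] assms(1) by auto
    then show False using T by (auto simp: transversal_def)
  qed
  show ?thesis
  proof
    show "min_transversals E ?C \<subseteq> H"
    proof
      fix T assume T: "T \<in> min_transversals E ?C"
      then obtain B where B: "B \<in> H" "B \<subseteq> T"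
        using contains[of T] by (auto simp: min_transversals_def)
      then have "\<not> B \<subset> T" using T tr by (auto simp: min_transversals_def)
      then show "T \<in> H" using B by blast
    qed
    show "H \<subseteq> min_transversals E ?C"
    proof
      fix B assume B: "B \<in> H"
      have "\<not> transversal ?C T'" if T': "T' \<subset> B" for T'
        using contains[of T'] assms(3)[OF _ B] T' by blast
      then show "B \<in> min_transversals E ?C"
        using assms(2)[OF B] tr[OF B] by (subst min_transversals_def) simp
    qed
  qed
qed

text \<open>A set lies in the complement of a basis exactly if it misses that basis, so dependence
  in the dual means meeting every basis.\<close>

lemma circuits_dual:
  "circuits (dual M) = min_transversals (ground M) (bases M)"
proof -
  have *: "\<not> indep (dual M) C \<longleftrightarrow> transversal (bases M) C" if "C \<subseteq> ground M" for C
    using that unfolding indep_def dual_def transversal_def by auto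
  have "ground (dual M) = ground M" by (simp add: dual_def)
  moreover have "(\<forall>D. D \<subset> C \<longrightarrow> indep (dual M) D) \<longleftrightarrow> (\<forall>D. D \<subset> C \<longrightarrow> \<not> transversal (bases M) D)"
    if "C \<subseteq> ground M" for C
    using that * by (meson psubset_imp_subset subset_trans)
  ultimately show ?thesis
    unfolding circuits_def min_transversals_def using * by metis
qed

text \<open>This is the closure of \<open>I\<close> only if \<open>I\<close> is independent.\<close>

definition cl :: "'e base_system \<Rightarrow> 'e set \<Rightarrow> 'e set" where
  "cl M I = {e \<in> ground M. e \<in> I \<or> \<not> indep M (insert e I)}"

section \<open>Exchange, extension and augmentation\<close>

locale matroid_bases =
  fixes M :: "'e base_system"
  assumes matroid: "matroid M"
begin

lemma finite_ground: "finite (ground M)"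
  and bases_nonempty: "bases M \<noteq> {}"
  and base_subset: "B \<in> bases M \<Longrightarrow> B \<subseteq> ground M"
  and exchange: "A \<in> bases M \<Longrightarrow> B \<in> bases M \<Longrightarrow> x \<in> A - B \<Longrightarrow>
    \<exists>y\<in>B - A. insert y (A - {x}) \<in> bases M"
  using matroid by (auto simp: matroid_def)

lemma finite_base: "B \<in> bases M \<Longrightarrow> finite B"
  using base_subset finite_ground finite_subset by blast

lemma card_bases_eq:
  assumes "A \<in> bases M" "B \<in> bases M"
  shows "card A = card B"
  using assms
proof (induction "card (A - B)" arbitrary: A rule: less_induct)
  case less
  show ?case
  proof (cases "A - B = {}")
    case True
    \<comment> \<open>Exchange in the other direction: an element of \<open>B - A\<close> would have
      to be replaced by one of the empty set \<open>A - B\<close>.\<close>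
    have "B - A = {}"
      using exchange[OF less.prems(2,1)] True by blast
    then show ?thesis using True by (metis Diff_eq_empty_iff subset_antisym)
  next
    case False
    then obtain x where x: "x \<in> A - B" by blast
    obtain y where y: "y \<in> B - A" "insert y (A - {x}) \<in> bases M"
      using exchange[OF less.prems x] by blast
    have fin: "finite A" using finite_base less.prems by blast
    have "insert y (A - {x}) - B = (A - B) - {x}" using y by blast
    then have "card (insert y (A - {x}) - B) < card (A - B)"
      using x fin by (metis card_Diff1_less finite_Diff)
    then have "card (insert y (A - {x})) = card B"
      using less.hyps y(2) less.prems(2) by blast
    moreover have "card (insert y (A - {x})) = card A"
      using x y fin card_Suc_Diff1[of A x] by simp
    ultimately show ?thesis by simp
  qed
qed

lemma indep_subset: "indep M J \<Longrightarrow> I \<subseteq> J \<Longrightarrow> indep M I"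
  by (auto simp: indep_def)

lemma indep_ground: "indep M I \<Longrightarrow> I \<subseteq> ground M"
  using base_subset by (auto simp: indep_def)

lemma indep_finite: "indep M I \<Longrightarrow> finite I"
  using indep_ground finite_ground finite_subset by blast

text \<open>Start from any basis above \<open>I\<close> and exchange its elements outside
  \<open>I \<union> B\<close> for elements of \<open>B\<close>; each exchange leaves one fewer of
  them.\<close>

lemma extend_into_base:
  assumes "indep M I" "B \<in> bases M"
  shows "\<exists>A\<in>bases M. I \<subseteq> A \<and> A \<subseteq> I \<union> B"
proof -
  have "\<exists>A'\<in>bases M. I \<subseteq> A' \<and> A' \<subseteq> I \<union> B" if "A \<in> bases M" "I \<subseteq> A" for A
    using that
  proof (induction "card (A - (I \<union> B))" arbitrary: A rule: less_induct)
    case less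
    show ?case
    proof (cases "A - (I \<union> B) = {}")
      case False
      then obtain x where x: "x \<in> A - (I \<union> B)" by blast
      obtain y where y: "y \<in> B - A" "insert y (A - {x}) \<in> bases M"
        using exchange[OF less.prems(1) assms(2), of x] x by blast
      have "insert y (A - {x}) - (I \<union> B) = (A - (I \<union> B)) - {x}" using y by blast
      then have "card (insert y (A - {x}) - (I \<union> B)) < card (A - (I \<union> B))"
        using x finite_base[OF less.prems(1)] by (metis card_Diff1_less finite_Diff)
      moreover have "I \<subseteq> insert y (A - {x})" using x less.prems(2) by blast
      ultimately show ?thesis using less.hyps y(2) by blast
    qed (use less.prems in blast)
  qed
  then show ?thesis using assms(1) by (auto simp: indep_def)
qed

text \<open>Extend \<open>I\<close> to a basis inside \<open>I \<union> B\<close>, where the basis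
  \<open>B\<close> contains \<open>J\<close>. If no element of \<open>J - I\<close> can be added,
  this basis lies in \<open>I \<union> (B - J)\<close>, which is too small.\<close>

lemma augment:
  assumes "indep M I" "indep M J" "card I < card J"
  shows "\<exists>x\<in>J - I. indep M (insert x I)"
proof (rule ccontr)
  assume neg: "\<not> ?thesis"
  obtain B where B: "B \<in> bases M" "J \<subseteq> B" using assms(2) by (auto simp: indep_def)
  obtain A where A: "A \<in> bases M" "I \<subseteq> A" "A \<subseteq> I \<union> B"
    using extend_into_base[OF assms(1) B(1)] by blast
  have "A \<subseteq> I \<union> (B - J)"
  proof
    fix x assume x: "x \<in> A"
    have "x \<notin> J - I"
      using neg A x by (auto simp: indep_def)
    then show "x \<in> I \<union> (B - J)" using A x by blast
  qed
  then have "card A \<le> card (I \<union> (B - J))"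
    using indep_finite assms(1) finite_base B by (intro card_mono) auto
  also have "\<dots> \<le> card I + card (B - J)" by (rule card_Un_le)
  also have "card (B - J) = card B - card J"
    using B finite_base by (meson card_Diff_subset finite_subset)
  also have "card I + (card B - card J) < card B"
    using assms(3) card_mono[OF finite_base[OF B(1)] B(2)] by linarith
  finally show False using card_bases_eq[OF A(1) B(1)] by simp
qed

lemma card_base_indep:
  assumes "indep M I" "B \<in> bases M"
  shows "card I \<le> card B"
  using assms card_bases_eq card_mono finite_base unfolding indep_def by metis

lemma indep_base:
  assumes "indep M I" "B \<in> bases M" "card I = card B"
  shows "I \<in> bases M"
  using assms card_bases_eq card_subset_eq finite_base unfolding indep_def by metis

section \<open>Closures of independent sets\<close>

lemma cl_ground: "cl M I \<subseteq> ground M"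
  by (auto simp: cl_def)

lemma finite_cl: "finite (cl M I)"
  using cl_ground finite_ground finite_subset by blast

lemma subset_cl: "I \<subseteq> ground M \<Longrightarrow> I \<subseteq> cl M I"
  by (auto simp: cl_def)

lemma cl_mono_insert: "cl M I \<subseteq> cl M (insert e I)"
  unfolding cl_def using indep_subset by (auto intro: indep_subset)

lemma notin_cl:
  "e \<in> ground M - cl M I \<longleftrightarrow> e \<in> ground M \<and> e \<notin> I \<and> indep M (insert e I)"
  by (auto simp: cl_def)

text \<open>A larger \<open>J\<close> would augment \<open>I\<close> by an element that the closure
  excludes.\<close>

lemma card_indep_cl:
  assumes "indep M I" "indep M J" "J \<subseteq> cl M I"
  shows "card J \<le> card I"
proof (rule ccontr)
  assume "\<not> card J \<le> card I"
  then obtain x where "x \<in> J - I" "indep M (insert x I)"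
    using augment[OF assms(1,2)] by auto
  then show False using assms(3) by (auto simp: cl_def)
qed

lemma finite_ranks: "X \<subseteq> ground M \<Longrightarrow> finite (card ` {I. I \<subseteq> X \<and> indep M I})"
  using finite_ground by (simp add: finite_subset)

lemma rank_of_eqI:
  assumes "X \<subseteq> ground M" "I \<subseteq> X" "indep M I" "\<And>J. J \<subseteq> X \<Longrightarrow> indep M J \<Longrightarrow> card J \<le> card I"
  shows "rank_of M X = card I"
  unfolding rank_of_def using assms by (intro Max_eqI finite_ranks) auto

lemma rank_cl: "indep M I \<Longrightarrow> rank_of M (cl M I) = card I"
  using card_indep_cl by (intro rank_of_eqI cl_ground subset_cl indep_ground) auto

lemma rank_ground: "B \<in> bases M \<Longrightarrow> rank_of M (ground M) = card B"
  by (rule rank_of_eqI) (auto simp: base_subset card_base_indep indep_def)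

text \<open>Together with \<open>rank_cl\<close> this turns the hypothesis on flats of a perfect
  matroid design into one on closures of independent sets, the only form in which it is
  used.\<close>

lemma flat_cl:
  assumes I: "indep M I"
  shows "flat M (cl M I)"
  unfolding flat_def
proof (intro conjI ballI)
  fix e assume e: "e \<in> ground M - cl M I"
  then have ins: "indep M (insert e I)" "e \<notin> I" using notin_cl by blast+
  have sub: "insert e (cl M I) \<subseteq> ground M" using e cl_ground by blast
  have "insert e I \<subseteq> insert e (cl M I)" using subset_cl[OF indep_ground[OF I]] by blast
  then have "card (insert e I) \<le> rank_of M (insert e (cl M I))"
    unfolding rank_of_def using ins sub by (intro Max_ge finite_ranks) auto
  then show "rank_of M (cl M I) < rank_of M (insert e (cl M I))"
    using rank_cl[OF I] ins indep_finite[OF I] by simp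
qed (rule cl_ground)

text \<open>Two elements outside a closed set lie in the same cover of it; the relation is symmetric by
  definition, which is what the double counting arguments below need.\<close>

lemma cl_insert_sym:
  assumes "e \<in> ground M - cl M I" "e' \<in> ground M - cl M I"
  shows "e' \<in> cl M (insert e I) \<longleftrightarrow> e \<in> cl M (insert e' I)"
  using assms by (auto simp: cl_def insert_commute)

lemma cl_base: "B \<in> bases M \<Longrightarrow> cl M B = ground M"
proof -
  assume B: "B \<in> bases M"
  have "\<not> indep M (insert e B)" if "e \<notin> B" for e
    using card_base_indep[OF _ B, of "insert e B"] that finite_base[OF B] by auto
  then show ?thesis by (auto simp: cl_def)
qed

lemma cl_empty: "cl M {} = loops M"
  by (auto simp: cl_def loops_def indep_def)

section \<open>Cocircuits as complements of hyperplanes\<close>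

lemma insert_is_base:
  assumes "indep M I" "B \<in> bases M" "Suc (card I) = card B" "e \<in> ground M - cl M I"
  shows "insert e I \<in> bases M"
proof -
  have "indep M (insert e I)" "e \<notin> I" using assms(4) notin_cl by blast+
  moreover from this have "card (insert e I) = card B"
    using indep_finite[OF assms(1)] assms(3) by simp
  ultimately show ?thesis using indep_base assms(2) by blast
qed

text \<open>The hyperplane \<open>cl M I\<close> is too small in rank to contain a basis, so its
  complement meets all of them. Leaving out an element \<open>e\<close> of the complement is
  impossible, since \<open>insert e I\<close> is a basis meeting the complement in \<open>e\<close>
  alone.\<close>

lemma hyperplane_complement:
  assumes I: "indep M I" and B: "B \<in> bases M" and card: "Suc (card I) = card B"
  shows "ground M - cl M I \<in> min_transversals (ground M) (bases M)"
  unfolding min_transversals_def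
proof (intro CollectI conjI allI impI)
  show "transversal (bases M) (ground M - cl M I)"
    unfolding transversal_def
  proof
    fix A assume A: "A \<in> bases M"
    have "\<not> A \<subseteq> cl M I"
      using card_indep_cl[OF I, of A] A card card_bases_eq[OF A B] by (auto simp: indep_def)
    then show "A \<inter> (ground M - cl M I) \<noteq> {}" using base_subset[OF A] by blast
  qed
next
  fix T assume T: "T \<subset> ground M - cl M I"
  then obtain e where e: "e \<in> ground M - cl M I" "e \<notin> T" by blast
  have "insert e I \<in> bases M" using insert_is_base[OF I B card e(1)] .
  moreover have "insert e I \<inter> T = {}"
    using e(2) T subset_cl[OF indep_ground[OF I]] by blast
  ultimately show "\<not> transversal (bases M) T" unfolding transversal_def by blast
qed auto

text \<open>Minimality provides for each \<open>c\<close> in \<open>C\<close> a basis with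
  \<open>c\<close> as its only element in \<open>C\<close>. Removing \<open>c\<close> from one such
  basis gives \<open>I\<close>, and \<open>C\<close> is shown to be disjoint from
  \<open>cl M I\<close> and to contain everything outside it.\<close>

lemma min_transversal_hyperplane:
  assumes C: "C \<in> min_transversals (ground M) (bases M)"
  shows "\<exists>I. indep M I \<and> (\<forall>B\<in>bases M. Suc (card I) = card B) \<and> C = ground M - cl M I"
proof -
  have sub: "C \<subseteq> ground M" and tr: "transversal (bases M) C"
    and min: "\<And>T. T \<subset> C \<Longrightarrow> \<not> transversal (bases M) T"
    using C by (auto simp: min_transversals_def)
  have drop: "\<exists>B\<in>bases M. B \<inter> C = {c}" if "c \<in> C" for c
    using min[of "C - {c}"] that tr by (auto simp: transversal_def)
  obtain c where c: "c \<in> C" using tr bases_nonempty by (auto simp: transversal_def)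
  obtain B where B: "B \<in> bases M" "B \<inter> C = {c}" using drop[OF c] by blast
  define I where "I = B - {c}"
  have I: "indep M I" using B by (auto simp: indep_def I_def)
  have card: "Suc (card I) = card B"
    unfolding I_def using B finite_base by (intro card_Suc_Diff1) auto
  have "x \<notin> C" if x: "x \<in> cl M I" for x
  proof
    assume xC: "x \<in> C"
    obtain A where A: "A \<in> bases M" "A \<inter> C = {x}" using drop[OF xC] by blast
    \<comment> \<open>An \<open>a\<close> outside the closure completes \<open>I\<close> to a basis,
      which must meet \<open>C\<close>. As \<open>I\<close> misses \<open>C\<close>, this forces
      \<open>a\<close> into \<open>A \<inter> C = {x}\<close>, but \<open>x\<close> lies in the
      closure. Hence all of \<open>A\<close> would lie in a set of smaller rank.\<close>
    have "a \<in> cl M I" if a: "a \<in> A" for a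
    proof (rule ccontr)
      assume na: "a \<notin> cl M I"
      then have "a \<in> ground M - cl M I" using a base_subset A by blast
      then have "insert a I \<in> bases M" by (rule insert_is_base[OF I B(1) card])
      then have "insert a I \<inter> C \<noteq> {}" using tr by (auto simp: transversal_def)
      then have "a \<in> C" using B by (auto simp: I_def)
      then have "a = x" using A a by blast
      then show False using na x by blast
    qed
    then have "A \<subseteq> cl M I" by blast
    then show False
      using card_indep_cl[OF I, of A] A card card_bases_eq[OF A(1) B(1)]
      by (auto simp: indep_def)
  qed
  moreover have "x \<in> cl M I" if x: "x \<in> ground M - C" for x
  proof (rule ccontr)
    assume "x \<notin> cl M I"
    then have "x \<in> ground M - cl M I" using x by blast
    then have "insert x I \<in> bases M" by (rule insert_is_base[OF I B(1) card])
    then have "insert x I \<inter> C \<noteq> {}" using tr by (auto simp: transversal_def)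
    then show False using x B by (auto simp: I_def)
  qed
  ultimately have "C = ground M - cl M I" using sub cl_ground by blast
  then show ?thesis using I card card_bases_eq[OF _ B(1)] by metis
qed

lemma min_transversals_nonempty:
  assumes "{} \<notin> bases M"
  shows "min_transversals (ground M) (bases M) \<noteq> {}"
proof -
  have "transversal (bases M) (ground M)"
    unfolding transversal_def
  proof
    fix B assume "B \<in> bases M"
    then have "B \<subseteq> ground M" "B \<noteq> {}" using base_subset assms by auto
    then show "B \<inter> ground M \<noteq> {}" by blast
  qed
  then show ?thesis using min_transversal_exists[of "ground M" "ground M"] finite_ground by blast
qed

end

section \<open>Perfect matroid designs\<close>

text \<open>Here \<open>k\<close> is the rank and \<open>d\<close> the common size of the
  cocircuits. Equal cardinality of flats is phrased through closures of independent sets of equal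
  size.\<close>

locale perfect_design = matroid_bases +
  fixes k d :: nat
  assumes card_cl_eq: "indep M I \<Longrightarrow> indep M J \<Longrightarrow> card I = card J \<Longrightarrow> card (cl M I) = card (cl M J)"
    and card_base: "B \<in> bases M \<Longrightarrow> card B = k"
    and card_cocircuit: "C \<in> min_transversals (ground M) (bases M) \<Longrightarrow> card C = d"
    and rank_pos: "0 < k" and d_pos: "0 < d"
begin

text \<open>For independent \<open>I\<close> this is the set of elements that can still be added:
  the nonloops if \<open>I\<close> is empty, a cocircuit if \<open>I\<close> has
  \<open>k - 1\<close> elements, and empty if \<open>I\<close> is a basis.\<close>

definition coclosure :: "'a set \<Rightarrow> 'a set" where
  "coclosure I = ground M - cl M I"

lemma finite_coclosure: "finite (coclosure I)"
  unfolding coclosure_def using finite_ground by blast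

lemma coclosure_insert: "coclosure (insert e I) \<subseteq> coclosure I"
  unfolding coclosure_def using cl_mono_insert[of I e] by blast

lemma card_coclosure_eq:
  "indep M I \<Longrightarrow> indep M J \<Longrightarrow> card I = card J \<Longrightarrow> card (coclosure I) = card (coclosure J)"
  unfolding coclosure_def using card_cl_eq[of I J] cl_ground finite_cl
  by (simp add: card_Diff_subset)

lemma insert_indep:
  assumes "indep M I" "e \<in> coclosure I"
  shows "indep M (insert e I)" "card (insert e I) = Suc (card I)" "e \<notin> I"
proof -
  show *: "indep M (insert e I)" "e \<notin> I"
    using assms(2) notin_cl unfolding coclosure_def by blast+
  then show "card (insert e I) = Suc (card I)" using indep_finite assms(1) by simp
qed

lemma coclosure_hyperplane:
  assumes "indep M I" "Suc (card I) = k"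
  shows "coclosure I \<in> min_transversals (ground M) (bases M)"
proof -
  obtain B where B: "B \<in> bases M" using bases_nonempty by blast
  then show ?thesis
    unfolding coclosure_def using hyperplane_complement assms card_base by metis
qed

lemma indep_card_le: "indep M I \<Longrightarrow> card I \<le> k"
  using card_base_indep card_base unfolding indep_def by metis

lemma coclosure_nonempty:
  assumes "indep M I" "card I < k"
  shows "coclosure I \<noteq> {}"
proof -
  obtain B where B: "B \<in> bases M" using bases_nonempty by blast
  have "\<exists>x\<in>B - I. indep M (insert x I)"
    using augment[of I B] assms B card_base by (auto simp: indep_def)
  then show ?thesis using base_subset[OF B] notin_cl unfolding coclosure_def by blast
qed

text \<open>Averaging over the covers of a flat: an element \<open>e'\<close> outside \<open>cl I\<close> avoids \<open>cl (I + e)\<close> for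
  exactly \<open>card (coclosure (I + e'))\<close> choices of \<open>e\<close>, a number independent of \<open>e'\<close>.\<close>

lemma coclosure_weight:
  fixes y :: "'a \<Rightarrow> real"
  assumes "\<And>C. C \<in> min_transversals (ground M) (bases M) \<Longrightarrow> v \<le> sum y C"
    and "indep M I" "card I < k"
  shows "v * real (card (coclosure I)) \<le> real d * sum y (coclosure I)"
  using assms(2,3)
proof (induction "k - card I" arbitrary: I)
  case 0
  then show ?case by simp
next
  case (Suc j)
  show ?case
  proof (cases "Suc (card I) = k")
    case True
    then have C: "coclosure I \<in> min_transversals (ground M) (bases M)"
      using coclosure_hyperplane Suc.prems by blast
    then have "v * real d \<le> sum y (coclosure I) * real d"
      using assms(1) by (intro mult_right_mono) auto
    then show ?thesis using card_cocircuit[OF C] by (simp add: mult.commute)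
  next
    case False
    define D where "D = coclosure I"
    have finD: "finite D" by (simp add: D_def finite_coclosure)
    obtain e0 where e0: "e0 \<in> D"
      using coclosure_nonempty[OF Suc.prems] by (auto simp: D_def)
    define m where "m = card (coclosure (insert e0 I))"
    have m: "card (coclosure (insert e I)) = m" if "e \<in> D" for e
      unfolding m_def using that e0 insert_indep[OF Suc.prems(1)] D_def
      by (intro card_coclosure_eq) auto
    have step: "v * real m \<le> real d * sum y (coclosure (insert e I))" if e: "e \<in> D" for e
    proof -
      have "indep M (insert e I)" "card (insert e I) = Suc (card I)"
        using insert_indep[OF Suc.prems(1)] e by (auto simp: D_def)
      moreover have "Suc (card I) < k" using False Suc.prems(2) by simp
      ultimately show ?thesis using Suc.hyps(1)[of "insert e I"] Suc.hyps(2) m[OF e] by simp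
    qed
    \<comment> \<open>Positivity of \<open>m\<close> allows cancelling it at the end. For a
      hyperplane \<open>m\<close> would be zero, hence its separate treatment as the base
      case.\<close>
    have "indep M (insert e0 I)" "card (insert e0 I) < k"
      using insert_indep[OF Suc.prems(1)] e0 False Suc.prems(2) by (auto simp: D_def)
    then have mpos: "0 < m"
      unfolding m_def using coclosure_nonempty finite_coclosure by (simp add: card_gt_0_iff)
    have sub: "coclosure (insert e I) = {e'\<in>D. e' \<notin> cl M (insert e I)}" for e
      using cl_mono_insert[of I e] by (auto simp: coclosure_def D_def)
    have "(\<Sum>e\<in>D. sum y (coclosure (insert e I)))
        = (\<Sum>e\<in>D. \<Sum>e'\<in>D. if e' \<notin> cl M (insert e I) then y e' else 0)"
      unfolding sub using finD by (simp add: sum.inter_filter)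
    also have "\<dots> = (\<Sum>e'\<in>D. \<Sum>e\<in>D. if e' \<notin> cl M (insert e I) then y e' else 0)"
      by (rule sum.swap)
    also have "\<dots> = (\<Sum>e'\<in>D. \<Sum>e\<in>D. if e \<notin> cl M (insert e' I) then y e' else 0)"
    proof (intro sum.cong refl)
      fix e' e assume "e' \<in> D" "e \<in> D"
      then have "e' \<notin> cl M (insert e I) \<longleftrightarrow> e \<notin> cl M (insert e' I)"
        using cl_insert_sym[of e I e'] by (simp add: D_def coclosure_def)
      then show "(if e' \<notin> cl M (insert e I) then y e' else 0) =
        (if e \<notin> cl M (insert e' I) then y e' else 0)" by simp
    qed
    also have "\<dots> = (\<Sum>e'\<in>D. real m * y e')"
    proof (intro sum.cong refl)
      fix e' assume e': "e' \<in> D"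
      have "(\<Sum>e\<in>D. if e \<notin> cl M (insert e' I) then y e' else 0) = (\<Sum>e\<in>coclosure (insert e' I). y e')"
        unfolding sub by (rule sum.inter_filter[OF finD, symmetric])
      then show "(\<Sum>e\<in>D. if e \<notin> cl M (insert e' I) then y e' else 0) = real m * y e'"
        using m[OF e'] by simp
    qed
    also have "\<dots> = real m * sum y D" by (simp add: sum_distrib_left)
    finally have eq: "(\<Sum>e\<in>D. sum y (coclosure (insert e I))) = real m * sum y D" .
    have "real m * (v * real (card D)) = (\<Sum>e\<in>D. v * real m)" by simp
    also have "\<dots> \<le> (\<Sum>e\<in>D. real d * sum y (coclosure (insert e I)))"
      by (rule sum_mono) (rule step)
    also have "\<dots> = real m * (real d * sum y D)"
      by (simp add: eq flip: sum_distrib_left)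
    finally show ?thesis using mpos by (simp add: D_def)
  qed
qed

text \<open>The covers spanned by the elements completing \<open>I\<close> to a basis are disjoint modulo \<open>cl I\<close>, so
  that \<open>cl I\<close> has at least \<open>k - card I\<close> covers.\<close>

lemma coclosure_ratio_step:
  assumes I: "indep M I" "card I < k" and e: "e \<in> coclosure I"
  shows "card (coclosure I) * (k - Suc (card I)) \<le> card (coclosure (insert e I)) * (k - card I)"
proof -
  define D where "D = coclosure I"
  define m where "m = card (coclosure (insert e I))"
  have finD: "finite D" by (simp add: D_def finite_coclosure)
  obtain B where B: "B \<in> bases M" "I \<subseteq> B" using I by (auto simp: indep_def)
  have finB: "finite B" using finite_base B by blast
  have BD: "b \<in> D" if "b \<in> B - I" for b
  proof -
    have "indep M (insert b I)" using that B by (auto simp: indep_def)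
    then show ?thesis
      using that base_subset[OF B(1)] notin_cl[of b I] unfolding D_def coclosure_def by blast
  qed
  \<comment> \<open>The part outside \<open>cl M I\<close> of the cover spanned by \<open>I\<close>
    and \<open>b\<close>.\<close>
  define P where "P b = D - coclosure (insert b I)" for b
  have mle: "m \<le> card D"
    unfolding m_def D_def by (intro card_mono finite_coclosure coclosure_insert)
  have cardP: "card (P b) = card D - m" if b: "b \<in> B - I" for b
  proof -
    have "card (coclosure (insert b I)) = m"
      unfolding m_def using insert_indep[OF I(1)] e BD[OF b] D_def
      by (intro card_coclosure_eq) auto
    then show ?thesis unfolding P_def
      by (metis D_def card_Diff_subset coclosure_insert finite_coclosure)
  qed
  have disj: "P b \<inter> P c = {}" if bc: "b \<in> B - I" "c \<in> B - I" "b \<noteq> c" for b c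
  proof (rule ccontr)
    assume "P b \<inter> P c \<noteq> {}"
    then obtain x where x: "x \<in> D" "x \<in> cl M (insert b I)" "x \<in> cl M (insert c I)"
      by (auto simp: P_def D_def coclosure_def)
    have ix: "indep M (insert x I)" "card (insert x I) = Suc (card I)" "x \<notin> I"
      using insert_indep[OF I(1)] x(1) by (auto simp: D_def)
    \<comment> \<open>Augmenting \<open>insert x I\<close> from this set makes \<open>x\<close>
      independent of \<open>insert b I\<close> or of \<open>insert c I\<close>, although
      \<open>x\<close> lies in both closures.\<close>
    have ibc: "indep M (insert b (insert c I))" using bc B by (auto simp: indep_def)
    have "finite I" using I indep_finite by blast
    then have "card (insert b (insert c I)) = Suc (Suc (card I))" using bc by simp
    then obtain z where z: "z \<in> insert b (insert c I) - insert x I" "indep M (insert z (insert x I))"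
      using augment[OF ix(1) ibc] ix(2) by auto
    then have "z = b \<or> z = c" by blast
    moreover have "x \<notin> insert z I" using z(1) ix(3) by blast
    ultimately show False
      using z(2) x by (auto simp: cl_def insert_commute)
  qed
  have "(\<Sum>b\<in>B - I. card (P b)) = card (\<Union>b\<in>B - I. P b)"
    using finB finD disj by (intro card_UN_disjoint[symmetric]) (auto simp: P_def)
  also have "\<dots> \<le> card D" using finD by (intro card_mono) (auto simp: P_def)
  finally have "card (B - I) * (card D - m) \<le> card D" using cardP by simp
  moreover have "card (B - I) = k - card I"
    using B finB card_base by (metis card_Diff_subset finite_subset)
  ultimately have *: "(k - card I) * (card D - m) \<le> card D" by simp
  obtain q where q: "k - card I = Suc q" using I(2) by (metis Suc_diff_Suc)
  have "k - Suc (card I) = q" using q by simp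
  \<comment> \<open>This rearranges \<open>Suc q * (card D - m) \<le> card D\<close>;
    \<open>m \<le> card D\<close> makes the truncated subtraction exact.\<close>
  moreover have "card D * q \<le> m * Suc q"
    using * mle unfolding q by (simp add: algebra_simps diff_mult_distrib2)
  ultimately show ?thesis using q by (simp add: D_def m_def)
qed

text \<open>By the preceding lemma the quotient of \<open>card (coclosure I)\<close> by
  \<open>k - card I\<close> does not decrease as \<open>I\<close> grows; its value at the empty set
  is the bound. The form without division also covers bases, where the left side is zero.\<close>

lemma coclosure_ratio:
  assumes "indep M I"
  shows "card (coclosure {}) * (k - card I) \<le> card (coclosure I) * k"
proof -
  have "finite I" using assms indep_finite by blast
  then show ?thesis using assms
  proof (induction I)
    case empty
    then show ?case by simp
  next
    case (insert e I)
    have I: "indep M I" using insert.prems indep_subset by blast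
    have e: "e \<in> coclosure I"
      using insert.prems insert.hyps(2) notin_cl[of e I] indep_ground[of "insert e I"]
      unfolding coclosure_def by blast
    have less: "card I < k" using indep_card_le[OF insert.prems] insert.hyps by simp
    have "(k - card I) * (card (coclosure {}) * (k - Suc (card I)))
      \<le> k * (card (coclosure I) * (k - Suc (card I)))"
      using mult_right_mono[OF insert.IH[OF I], of "k - Suc (card I)"] by (simp add: mult_ac)
    also have "\<dots> \<le> k * (card (coclosure (insert e I)) * (k - card I))"
      using coclosure_ratio_step[OF I less e] by (intro mult_left_mono) auto
    finally have "(k - card I) * (card (coclosure {}) * (k - Suc (card I)))
      \<le> (k - card I) * (card (coclosure (insert e I)) * k)" by (simp add: mult_ac)
    then show ?case using less insert.hyps by simp
  qed
qed

text \<open>This pays for one greedy step: lowering \<open>w\<close> by one unit on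
  \<open>coclosure I\<close> costs a basis above \<open>I\<close> exactly \<open>k - card I\<close>
  units of weight and lowers the sum of \<open>w e * y e\<close> by
  \<open>sum y (coclosure I)\<close>.\<close>

lemma coclosure_bound:
  fixes y :: "'a \<Rightarrow> real"
  assumes "\<And>C. C \<in> min_transversals (ground M) (bases M) \<Longrightarrow> v \<le> sum y C" "0 \<le> v"
    and I: "indep M I" "card I < k"
  shows "v * real (card (coclosure {})) * (real k - real (card I)) \<le> real k * real d * sum y (coclosure I)"
proof -
  have "card (coclosure {}) * (k - card I) \<le> card (coclosure I) * k"
    by (rule coclosure_ratio[OF I(1)])
  then have "real (card (coclosure {})) * (real k - real (card I)) \<le> real (card (coclosure I)) * real k"
    using I(2) by (metis of_nat_diff less_imp_le of_nat_le_iff of_nat_mult)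
  then have "v * (real (card (coclosure {})) * (real k - real (card I)))
      \<le> v * (real (card (coclosure I)) * real k)"
    using assms(2) by (rule mult_left_mono)
  also have "\<dots> = real k * (v * real (card (coclosure I)))" by simp
  also have "\<dots> \<le> real k * (real d * sum y (coclosure I))"
    using coclosure_weight[OF assms(1) I] by (intro mult_left_mono) auto
  finally show ?thesis by (simp add: mult_ac)
qed

text \<open>The greedy algorithm: subtract the minimal available weight and recurse.\<close>

lemma greedy_base:
  fixes w y :: "'a \<Rightarrow> real"
  assumes y: "\<And>C. C \<in> min_transversals (ground M) (bases M) \<Longrightarrow> v \<le> sum y C" "0 \<le> v"
      "\<And>e. 0 \<le> y e"
    and "indep M I" "\<And>e. e \<in> coclosure I \<Longrightarrow> 0 \<le> w e"
  shows "\<exists>B\<in>bases M. I \<subseteq> B \<and>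
    v * real (card (coclosure {})) * sum w (B - I) \<le> real k * real d * (\<Sum>e\<in>coclosure I. w e * y e)"
  using assms(4,5)
proof (induction "k - card I" arbitrary: I w)
  case 0
  obtain B where B: "B \<in> bases M" using bases_nonempty by blast
  have "card I = card B" using 0 indep_card_le[of I] card_base[OF B] by simp
  then have "I \<in> bases M" using indep_base 0 B by blast
  moreover have "coclosure I = {}"
    using cl_base[OF \<open>I \<in> bases M\<close>] by (simp add: coclosure_def)
  ultimately show ?case by (intro bexI[of _ I]) auto
next
  case (Suc j)
  let ?N = "real (card (coclosure {}))"
  let ?K = "real k * real d"
  have less: "card I < k" using Suc.hyps(2) by linarith
  obtain b where b: "b \<in> coclosure I" "\<And>e. e \<in> coclosure I \<Longrightarrow> w b \<le> w e"
    using ex_min_if_finite[OF finite_imageI[OF finite_coclosure[of I], of w]]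
      coclosure_nonempty[OF Suc.prems(1) less]
    by (metis (no_types, lifting) arg_min_least arg_min_if_finite(1) finite_coclosure)
  have ib: "indep M (insert b I)" "card (insert b I) = Suc (card I)" "b \<notin> I"
    using insert_indep[OF Suc.prems(1) b(1)] .
  \<comment> \<open>Zero at \<open>b\<close>, so adding \<open>b\<close> to \<open>I\<close> is
    free. On \<open>cl M I\<close> the difference may be negative, which is why the induction
    demands nonnegative weights on \<open>coclosure I\<close> only.\<close>
  define w' where "w' e = w e - w b" for e
  have nonneg: "0 \<le> w' e" if "e \<in> coclosure I" for e using b(2)[OF that] by (simp add: w'_def)
  have "\<exists>B\<in>bases M. insert b I \<subseteq> B \<and>
      v * ?N * sum w' (B - insert b I) \<le> ?K * (\<Sum>e\<in>coclosure (insert b I). w' e * y e)"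
  proof (rule Suc.hyps(1))
    show "j = k - card (insert b I)" using Suc.hyps(2) ib(2) by simp
    show "0 \<le> w' e" if "e \<in> coclosure (insert b I)" for e
      using nonneg coclosure_insert that by blast
  qed (rule ib(1))
  then obtain B where B: "B \<in> bases M" "insert b I \<subseteq> B"
    and IH: "v * ?N * sum w' (B - insert b I) \<le> ?K * (\<Sum>e\<in>coclosure (insert b I). w' e * y e)"
    by blast
  have finB: "finite B" and cB: "card B = k" using B finite_base card_base by auto
  have Bb: "B - I = insert b (B - insert b I)" using B(2) ib(3) by blast
  have "sum w' (B - I) = w' b + sum w' (B - insert b I)"
    unfolding Bb using finB by (intro sum.insert) auto
  then have "sum w' (B - I) = sum w' (B - insert b I)" by (simp add: w'_def)
  moreover have "sum w' (B - I) = sum w (B - I) - real (card (B - I)) * w b"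
    by (simp add: w'_def sum_subtractf)
  moreover have "card (B - I) = k - card I"
    using B(2) finB cB by (metis card_Diff_subset finite_subset insert_subset)
  ultimately have w: "sum w (B - I) = sum w' (B - insert b I) + (real k - real (card I)) * w b"
    using less by (simp add: of_nat_diff)
  have "(\<Sum>e\<in>coclosure (insert b I). w' e * y e) \<le> (\<Sum>e\<in>coclosure I. w' e * y e)"
    using nonneg y(3) by (intro sum_mono2 finite_coclosure coclosure_insert mult_nonneg_nonneg) auto
  then have "?K * (\<Sum>e\<in>coclosure (insert b I). w' e * y e) \<le> ?K * (\<Sum>e\<in>coclosure I. w' e * y e)"
    by (intro mult_left_mono) auto
  then have 1: "v * ?N * sum w' (B - insert b I) \<le> ?K * (\<Sum>e\<in>coclosure I. w' e * y e)"
    using IH by linarith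
  have 2: "w b * (v * ?N * (real k - real (card I))) \<le> w b * (?K * sum y (coclosure I))"
    using coclosure_bound[OF y(1,2) Suc.prems(1) less] Suc.prems(2)[OF b(1)]
    by (intro mult_left_mono) auto
  have 3: "(\<Sum>e\<in>coclosure I. w e * y e) = (\<Sum>e\<in>coclosure I. w' e * y e) + w b * sum y (coclosure I)"
    by (simp add: w'_def algebra_simps sum_subtractf flip: sum_distrib_left)
  have "v * ?N * sum w (B - I) = v * ?N * sum w' (B - insert b I) + w b * (v * ?N * (real k - real (card I)))"
    by (simp add: w algebra_simps)
  also have "\<dots> \<le> ?K * (\<Sum>e\<in>coclosure I. w' e * y e) + w b * (?K * sum y (coclosure I))"
    using 1 2 by linarith
  also have "\<dots> = ?K * (\<Sum>e\<in>coclosure I. w e * y e)" by (simp add: 3 algebra_simps)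
  finally show ?case using B by blast
qed

text \<open>The greedy basis grown from the empty set has weight at least \<open>u\<close>, and the
  coclosure of the empty set is the set of nonloops.\<close>

lemma base_cocircuit_inequality:
  fixes w y :: "'a \<Rightarrow> real"
  assumes "\<And>e. 0 \<le> w e" "\<And>e. 0 \<le> y e" "0 \<le> v"
    and u: "\<And>B. B \<in> bases M \<Longrightarrow> u \<le> sum w B"
    and v: "\<And>C. C \<in> min_transversals (ground M) (bases M) \<Longrightarrow> v \<le> sum y C"
  shows "u * v * real (card (ground M - loops M)) \<le> real k * real d * (\<Sum>e\<in>ground M. w e * y e)"
proof -
  let ?D = "coclosure {}"
  have D: "?D = ground M - loops M" by (simp add: coclosure_def cl_empty)
  have "indep M {}" using bases_nonempty by (auto simp: indep_def)
  then obtain B where B: "B \<in> bases M"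
    "v * real (card ?D) * sum w (B - {}) \<le> real k * real d * (\<Sum>e\<in>?D. w e * y e)"
    using greedy_base[OF v assms(3,2), of "{}" w] assms(1) by blast
  have "u * (v * real (card ?D)) \<le> sum w B * (v * real (card ?D))"
    using u[OF B(1)] assms(3) by (intro mult_right_mono) auto
  also have "\<dots> \<le> real k * real d * (\<Sum>e\<in>?D. w e * y e)" using B(2) by (simp add: mult_ac)
  also have "\<dots> \<le> real k * real d * (\<Sum>e\<in>ground M. w e * y e)"
    using assms(1,2) finite_ground
    by (intro mult_left_mono sum_mono2) (auto simp: coclosure_def)
  finally show ?thesis by (simp add: D mult_ac)
qed

end

section \<open>Packing\<close>

text \<open>The exponent vector of the product of the monomials \<open>x^B\<close>, each taken
  \<open>c B\<close> times; a bound \<open>load H c e \<le> a e\<close> for all \<open>e\<close>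
  says that this product divides \<open>x^a\<close>.\<close>

definition load :: "'a set set \<Rightarrow> ('a set \<Rightarrow> 'b::comm_monoid_add) \<Rightarrow> 'a \<Rightarrow> 'b" where
  "load H c e = (\<Sum>B\<in>H. if e \<in> B then c B else 0)"

lemma load_upd:
  assumes "finite H" "B \<in> H"
  shows "load H (c(B := Suc (c B))) e = load H c e + (if e \<in> B then 1 else 0)"
proof -
  have "load H c' e = (if e \<in> B then c' B else 0) + (\<Sum>A\<in>H - {B}. if e \<in> A then c' A else 0)" for c' :: "'a set \<Rightarrow> nat"
    unfolding load_def using assms by (rule sum.remove)
  moreover have "(\<Sum>A\<in>H - {B}. if e \<in> A then (c(B := Suc (c B))) A else 0)
      = (\<Sum>A\<in>H - {B}. if e \<in> A then c A else 0)"
    by (rule sum.cong) auto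
  ultimately show ?thesis by simp
qed

lemma sum_upd_Suc:
  assumes "finite H" "B \<in> H"
  shows "sum (c(B := Suc (c B))) H = Suc (sum c H)"
proof -
  have "sum (c(B := Suc (c B))) (H - {B}) = sum c (H - {B})" by (rule sum.cong) auto
  then show ?thesis using sum.remove[OF assms, of c] sum.remove[OF assms, of "c(B := Suc (c B))"] by simp
qed

text \<open>Replacing \<open>x\<close> by its positive part before adding \<open>t\<close> can only
  increase the result. This is the expansion of the quadratic potential along one step of the greedy
  packing.\<close>

lemma max_square_le:
  fixes x t :: real
  shows "(max 0 (x + t))\<^sup>2 \<le> (max 0 x)\<^sup>2 + 2 * max 0 x * t + t\<^sup>2"
proof -
  have "max 0 (x + t) \<le> \<bar>max 0 x + t\<bar>" by auto
  then have "(max 0 (x + t))\<^sup>2 \<le> (\<bar>max 0 x + t\<bar>)\<^sup>2" by (rule power_mono) simp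
  then show ?thesis by (simp add: power2_sum)
qed

text \<open>A discrete substitute for linear programming duality: always adding the member of \<open>H\<close> that is
  cheapest with respect to the current excess load keeps the sum of the squared excesses linear in
  the number of steps, so that the relative excess tends to zero. Elements of capacity zero get a
  prohibitive weight.\<close>

lemma greedy_load:
  fixes y :: "'a \<Rightarrow> real"
  assumes fin: "finite E" "finite H" and sub: "\<And>B. B \<in> H \<Longrightarrow> B \<subseteq> E" and y: "\<And>e. 0 \<le> y e"
    and sel: "\<And>w. (\<And>e. 0 \<le> w e) \<Longrightarrow> \<exists>B\<in>H. sum w B \<le> (\<Sum>e\<in>E. w e * y e)"
  shows "\<exists>c :: 'a set \<Rightarrow> nat. sum c H = T \<and> (\<forall>e\<in>E. y e = 0 \<longrightarrow> load H c e = 0) \<and>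
    (\<Sum>e\<in>E. (max 0 (real (load H c e) - real T * y e))\<^sup>2) \<le> real T * (\<Sum>e\<in>E. (1 + y e)\<^sup>2)"
proof (induction T)
  case 0
  show ?case by (rule exI[of _ "\<lambda>_. 0"]) (simp add: load_def)
next
  case (Suc T)
  then obtain c where c: "sum c H = T" "\<And>e. e \<in> E \<Longrightarrow> y e = 0 \<Longrightarrow> load H c e = 0"
    "(\<Sum>e\<in>E. (max 0 (real (load H c e) - real T * y e))\<^sup>2) \<le> real T * (\<Sum>e\<in>E. (1 + y e)\<^sup>2)"
    by blast
  define x where "x e = real (load H c e) - real T * y e" for e
  define X where "X = (\<Sum>e\<in>E. max 0 (x e) * y e)"
  \<comment> \<open>The factor \<open>y e = 0\<close> hides the weight \<open>X + 1\<close> from the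
    right side of the selection rule, which therefore equals \<open>X\<close>; a set containing such
    an element already costs more.\<close>
  define w where "w e = (if y e = 0 then X + 1 else max 0 (x e))" for e
  have X: "0 \<le> X" unfolding X_def using y by (intro sum_nonneg) auto
  then have w0: "0 \<le> w e" for e by (simp add: w_def)
  then obtain B where B: "B \<in> H" "sum w B \<le> (\<Sum>e\<in>E. w e * y e)" using sel[of w] by blast
  have "(\<Sum>e\<in>E. w e * y e) = X"
    unfolding X_def by (rule sum.cong) (auto simp: w_def)
  then have wB: "sum w B \<le> X" using B by simp
  have BE: "B \<subseteq> E" "finite B" using sub[OF B(1)] fin(1) finite_subset by auto
  have pos: "y e \<noteq> 0" if "e \<in> B" for e
  proof
    assume "y e = 0"
    then have "X + 1 \<le> sum w B"
      using member_le_sum[of e B w] that BE w0 by (simp add: w_def)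
    then show False using wB by simp
  qed
  \<comment> \<open>The change of the excess: after the next step it is
    \<open>x e + t e\<close>.\<close>
  define t where "t e = (if e \<in> B then 1 else 0) - y e" for e
  define c' where "c' = c(B := Suc (c B))"
  have load': "load H c' e = load H c e + (if e \<in> B then 1 else 0)" for e
    unfolding c'_def by (rule load_upd[OF fin(2) B(1)])
  \<comment> \<open>The linear term of the expansion is the cost of \<open>B\<close> minus the
    budget \<open>X\<close>, hence not positive; only the bounded squares of \<open>t\<close> make
    the potential grow.\<close>
  have "(\<Sum>e\<in>E. max 0 (x e) * t e) = (\<Sum>e\<in>E. if e \<in> B then max 0 (x e) else 0) - X"
    unfolding X_def sum_subtractf[symmetric] by (rule sum.cong) (auto simp: t_def algebra_simps)
  also have "(\<Sum>e\<in>E. if e \<in> B then max 0 (x e) else 0) = sum w B"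
  proof -
    have "(\<Sum>e\<in>E. if e \<in> B then max 0 (x e) else 0) = (\<Sum>e\<in>{e\<in>E. e \<in> B}. max 0 (x e))"
      by (rule sum.inter_filter[OF fin(1), symmetric])
    also have "{e\<in>E. e \<in> B} = B" using BE by blast
    also have "(\<Sum>e\<in>B. max 0 (x e)) = sum w B"
      using pos by (intro sum.cong) (auto simp: w_def)
    finally show ?thesis .
  qed
  finally have drift: "(\<Sum>e\<in>E. max 0 (x e) * t e) \<le> 0" using wB by simp
  have "(\<Sum>e\<in>E. (max 0 (real (load H c' e) - real (Suc T) * y e))\<^sup>2) = (\<Sum>e\<in>E. (max 0 (x e + t e))\<^sup>2)"
    by (intro sum.cong refl arg_cong[of _ _ "\<lambda>z. (max 0 z)\<^sup>2"])
      (simp add: load' x_def t_def algebra_simps)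
  also have "\<dots> \<le> (\<Sum>e\<in>E. (max 0 (x e))\<^sup>2 + 2 * max 0 (x e) * t e + (t e)\<^sup>2)"
    by (rule sum_mono) (rule max_square_le)
  also have "\<dots> = (\<Sum>e\<in>E. (max 0 (x e))\<^sup>2) + 2 * (\<Sum>e\<in>E. max 0 (x e) * t e) + (\<Sum>e\<in>E. (t e)\<^sup>2)"
    by (simp add: sum.distrib sum_distrib_left mult.assoc)
  also have "\<dots> \<le> real T * (\<Sum>e\<in>E. (1 + y e)\<^sup>2) + 0 + (\<Sum>e\<in>E. (1 + y e)\<^sup>2)"
  proof (intro add_mono)
    show "(\<Sum>e\<in>E. (t e)\<^sup>2) \<le> (\<Sum>e\<in>E. (1 + y e)\<^sup>2)"
    proof (rule sum_mono)
      fix e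
      have "\<bar>t e\<bar> \<le> \<bar>1 + y e\<bar>" using y[of e] by (auto simp: t_def)
      then show "(t e)\<^sup>2 \<le> (1 + y e)\<^sup>2" by (simp only: abs_le_square_iff)
    qed
  qed (use c(3) drift in \<open>simp_all add: x_def\<close>)
  finally have "(\<Sum>e\<in>E. (max 0 (real (load H c' e) - real (Suc T) * y e))\<^sup>2)
    \<le> real (Suc T) * (\<Sum>e\<in>E. (1 + y e)\<^sup>2)" by (simp add: algebra_simps)
  moreover have "sum c' H = Suc T" unfolding c'_def using sum_upd_Suc[OF fin(2) B(1)] c(1) by simp
  moreover have "\<forall>e\<in>E. y e = 0 \<longrightarrow> load H c' e = 0" using load' c(2) pos by auto
  ultimately show ?case by blast
qed

text \<open>Run the greedy packing for \<open>T\<close> steps with capacities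
  \<open>a e / Q\<close>. For large \<open>T\<close> its load is at most
  \<open>T * (1 + \<delta>)\<close> times these capacities, and
  \<open>(1 + \<delta>) * \<theta> = 1\<close>. Scaling by \<open>\<theta> * Q / T\<close> thus
  gives a fractional packing of size \<open>\<theta> * Q\<close> below \<open>a\<close>; rounding
  down costs at most one per member of \<open>H\<close>.\<close>

lemma integral_packing:
  fixes a :: "'a \<Rightarrow> nat" and Q \<theta> :: real
  assumes fin: "finite E" "finite H" and sub: "\<And>B. B \<in> H \<Longrightarrow> B \<subseteq> E"
    and Q: "0 < Q" and \<theta>: "0 < \<theta>" "\<theta> < 1"
    and sel: "\<And>w. (\<And>e. 0 \<le> w e) \<Longrightarrow> \<exists>B\<in>H. Q * sum w B \<le> (\<Sum>e\<in>E. w e * real (a e))"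
  shows "\<exists>c :: 'a set \<Rightarrow> nat. \<theta> * Q - real (card H) \<le> real (sum c H) \<and> (\<forall>e\<in>E. load H c e \<le> a e)"
proof -
  define y where "y e = real (a e) / Q" for e
  define K where "K = (\<Sum>e\<in>E. (1 + y e)\<^sup>2)"
  define \<delta> where "\<delta> = 1 / \<theta> - 1"
  have y: "0 \<le> y e" for e using Q by (simp add: y_def)
  have \<delta>: "0 < \<delta>" using \<theta> by (simp add: \<delta>_def)
  have K: "0 \<le> K" unfolding K_def by (intro sum_nonneg) auto
  have sel': "\<exists>B\<in>H. sum w B \<le> (\<Sum>e\<in>E. w e * y e)" if w: "\<And>e. 0 \<le> w e" for w
  proof -
    obtain B where B: "B \<in> H" "Q * sum w B \<le> (\<Sum>e\<in>E. w e * real (a e))"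
      using sel[of w] w by blast
    moreover have "(\<Sum>e\<in>E. w e * real (a e)) = Q * (\<Sum>e\<in>E. w e * y e)"
      using Q by (simp add: y_def sum_distrib_left)
    ultimately have "Q * sum w B \<le> Q * (\<Sum>e\<in>E. w e * y e)" by simp
    then have "sum w B \<le> (\<Sum>e\<in>E. w e * y e)" using Q by (rule mult_left_le_imp_le)
    then show ?thesis using B(1) by blast
  qed
  \<comment> \<open>A number of steps \<open>T \<ge> Z\<close> ensures that the potential bound
    \<open>T * K\<close> is at most \<open>(T * \<delta> * y e)\<^sup>2\<close> for each
    \<open>e\<close> of positive capacity. Elements with \<open>y e = 0\<close> contribute a
    division by zero, that is, zero.\<close>
  define Z where "Z = (\<Sum>e\<in>E. K / (\<delta> * y e)\<^sup>2)"
  define T where "T = Suc (nat \<lceil>Z\<rceil>)"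
  have TZ: "Z \<le> real T" unfolding T_def by linarith
  have Tpos: "0 < real T" by (simp add: T_def)
  obtain c where c: "sum c H = T" "\<And>e. e \<in> E \<Longrightarrow> y e = 0 \<Longrightarrow> load H c e = 0"
    "(\<Sum>e\<in>E. (max 0 (real (load H c e) - real T * y e))\<^sup>2) \<le> real T * K"
    using greedy_load[OF fin sub y sel', of T] unfolding K_def by blast
  have bound: "real (load H c e) \<le> real T * (1 + \<delta>) * y e" if e: "e \<in> E" for e
  proof (cases "y e = 0")
    case True
    then show ?thesis using c(2)[OF e] by simp
  next
    case False
    then have pos: "0 < \<delta> * y e" using y[of e] \<delta> by simp
    have "K / (\<delta> * y e)\<^sup>2 \<le> Z"
      unfolding Z_def using K by (intro member_le_sum[OF e _ fin(1)]) auto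
    then have "K / (\<delta> * y e)\<^sup>2 \<le> real T" using TZ by linarith
    then have "K \<le> real T * (\<delta> * y e)\<^sup>2"
      using pos by (subst (asm) pos_divide_le_eq) auto
    then have "real T * K \<le> real T * (real T * (\<delta> * y e)\<^sup>2)" by (intro mult_left_mono) auto
    also have "\<dots> = (real T * (\<delta> * y e))\<^sup>2" by (simp add: power2_eq_square)
    finally have "real T * K \<le> (real T * (\<delta> * y e))\<^sup>2" .
    moreover have "(max 0 (real (load H c e) - real T * y e))\<^sup>2
        \<le> (\<Sum>e\<in>E. (max 0 (real (load H c e) - real T * y e))\<^sup>2)"
      by (rule member_le_sum[OF e _ fin(1)]) simp
    ultimately have "(max 0 (real (load H c e) - real T * y e))\<^sup>2 \<le> (real T * (\<delta> * y e))\<^sup>2"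
      using c(3) by linarith
    then have "max 0 (real (load H c e) - real T * y e) \<le> real T * (\<delta> * y e)"
      by (rule power2_le_imp_le) (use pos Tpos in simp)
    then show ?thesis by (simp add: algebra_simps)
  qed
  define l where "l B = real (c B) * (\<theta> * Q / real T)" for B
  have l0: "0 \<le> l B" for B using \<theta> Q Tpos by (simp add: l_def)
  define f where "f B = nat \<lfloor>l B\<rfloor>" for B
  have f: "real (f B) \<le> l B" "l B - 1 \<le> real (f B)" for B
    using l0[of B] by (simp_all add: f_def)
  have "sum l H = real (sum c H) * (\<theta> * Q / real T)"
    unfolding l_def by (simp add: sum_distrib_right sum_divide_distrib)
  then have "sum l H = \<theta> * Q" using c(1) Tpos by simp
  moreover have "(\<Sum>B\<in>H. l B - 1) \<le> (\<Sum>B\<in>H. real (f B))" by (rule sum_mono) (rule f(2))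
  ultimately have "\<theta> * Q - real (card H) \<le> real (sum f H)" by (simp add: sum_subtractf)
  moreover have "load H f e \<le> a e" if e: "e \<in> E" for e
  proof -
    have "real (load H f e) = (\<Sum>B\<in>H. if e \<in> B then real (f B) else 0)"
      unfolding load_def of_nat_sum by (rule sum.cong) auto
    also have "\<dots> \<le> (\<Sum>B\<in>H. if e \<in> B then l B else 0)" by (rule sum_mono) (use f in auto)
    also have "\<dots> = (\<Sum>B\<in>H. (if e \<in> B then real (c B) else 0) * (\<theta> * Q / real T))"
      by (rule sum.cong) (auto simp: l_def)
    also have "\<dots> = real (load H c e) * (\<theta> * Q / real T)"
      unfolding load_def of_nat_sum sum_distrib_right by (rule sum.cong) auto
    also have "\<dots> \<le> (real T * (1 + \<delta>) * y e) * (\<theta> * Q / real T)"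
      using bound[OF e] \<theta> Q Tpos by (intro mult_right_mono) auto
    also have "\<dots> = ((1 + \<delta>) * \<theta>) * (y e * Q)" using Tpos by simp
    also have "\<dots> = real (a e)" using \<theta> Q by (simp add: \<delta>_def y_def)
    finally show ?thesis by simp
  qed
  ultimately show ?thesis by blast
qed

section \<open>Monomial ideals\<close>

abbreviation lu :: "('a \<Rightarrow>\<^sub>0 'b::zero) \<Rightarrow> 'a \<Rightarrow> 'b" where "lu \<equiv> Poly_Mapping.lookup"
abbreviation single :: "'a \<Rightarrow> 'b::zero \<Rightarrow> 'a \<Rightarrow>\<^sub>0 'b" where "single \<equiv> Poly_Mapping.single"
abbreviation keys :: "('a \<Rightarrow>\<^sub>0 'b::zero) \<Rightarrow> 'a set" where "keys \<equiv> Poly_Mapping.keys"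

definition exps :: "'e set \<Rightarrow> ('e \<Rightarrow>\<^sub>0 nat) set" where
  "exps E = {m. keys m \<subseteq> E}"

definition upset :: "'e set \<Rightarrow> ('e \<Rightarrow>\<^sub>0 nat) set \<Rightarrow> bool" where
  "upset E U \<longleftrightarrow> U \<subseteq> exps E \<and> (\<forall>m\<in>U. \<forall>n\<in>exps E. m + n \<in> U)"

text \<open>An ideal only if \<open>U\<close> is an \<open>upset\<close>. Working with the exponent
  set turns inclusions, products and intersections of such ideals into operations on sets of
  exponents.\<close>

definition monomial_ideal :: "('e \<Rightarrow>\<^sub>0 nat) set \<Rightarrow> ('e, 'k::field) mpoly set" where
  "monomial_ideal U = {p. keys p \<subseteq> U}"

definition sumset :: "('e \<Rightarrow>\<^sub>0 nat) set \<Rightarrow> ('e \<Rightarrow>\<^sub>0 nat) set \<Rightarrow> ('e \<Rightarrow>\<^sub>0 nat) set" where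
  "sumset U V = {a + b | a b. a \<in> U \<and> b \<in> V}"

text \<open>For \<open>H\<close> consisting of subsets of \<open>E\<close>, these are the exponents
  of the squarefree monomial ideal generated by \<open>H\<close>.\<close>

definition supported :: "'e set \<Rightarrow> 'e set set \<Rightarrow> ('e \<Rightarrow>\<^sub>0 nat) set" where
  "supported E H = {m \<in> exps E. \<exists>B\<in>H. B \<subseteq> keys m}"

text \<open>For \<open>C \<subseteq> E\<close>, these are the exponents of the prime ideal generated
  by the variables in \<open>C\<close>.\<close>

definition meeting :: "'e set \<Rightarrow> 'e set \<Rightarrow> ('e \<Rightarrow>\<^sub>0 nat) set" where
  "meeting E C = {m \<in> exps E. keys m \<inter> C \<noteq> {}}"

lemma poly_ring_simps [simp]:
  "carrier (poly_ring E) = monomial_ideal (exps E)"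
  "p \<otimes>\<^bsub>poly_ring E\<^esub> q = p * q" "p \<oplus>\<^bsub>poly_ring E\<^esub> q = p + q"
  "\<one>\<^bsub>poly_ring E\<^esub> = 1" "\<zero>\<^bsub>poly_ring E\<^esub> = 0"
  by (auto simp: poly_ring_def monomial_ideal_def exps_def)

lemma keys_add_nat: "keys (m + n :: 'a \<Rightarrow>\<^sub>0 nat) = keys m \<union> keys n"
  by (auto simp: in_keys_iff lookup_add)

lemma exps_add [simp]: "m + n \<in> exps E \<longleftrightarrow> m \<in> exps E \<and> n \<in> exps E"
  by (simp add: exps_def keys_add_nat)

lemma exps_zero [simp]: "0 \<in> exps E"
  by (simp add: exps_def)

lemma upset_subset: "upset E U \<Longrightarrow> U \<subseteq> exps E"
  by (simp add: upset_def)

lemma upset_supported: "upset E (supported E H)"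
  by (auto simp: upset_def supported_def keys_add_nat)

lemma upset_meeting: "upset E (meeting E C)"
  by (auto simp: upset_def meeting_def keys_add_nat)

lemma monomial_ideal_mono: "monomial_ideal U \<subseteq> monomial_ideal V \<longleftrightarrow> U \<subseteq> V"
proof
  assume *: "(monomial_ideal U :: ('a, 'b) mpoly set) \<subseteq> monomial_ideal V"
  show "U \<subseteq> V"
  proof
    fix m assume "m \<in> U"
    then have "(single m 1 :: ('a, 'b) mpoly) \<in> monomial_ideal U" by (simp add: monomial_ideal_def)
    then have "(single m 1 :: ('a, 'b) mpoly) \<in> monomial_ideal V" using * by blast
    then show "m \<in> V" by (simp add: monomial_ideal_def)
  qed
qed (auto simp: monomial_ideal_def)

lemma single_in_monomial_ideal: "m \<in> U \<Longrightarrow> single m c \<in> monomial_ideal U"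
  by (simp add: monomial_ideal_def)

lemma sum_monomials:
  fixes p :: "'a \<Rightarrow>\<^sub>0 'b::comm_monoid_add"
  shows "(\<Sum>m\<in>keys p. single m (lu p m)) = p"
proof (rule poly_mapping_eqI)
  fix x
  have "lu (\<Sum>m\<in>keys p. single m (lu p m)) x = (\<Sum>m\<in>keys p. if x = m then lu p m else 0)"
    unfolding lookup_sum by (intro sum.cong) (auto simp: lookup_single when_def)
  also have "\<dots> = lu p x" by (auto simp: in_keys_iff)
  finally show "lu (\<Sum>m\<in>keys p. single m (lu p m)) x = lu p x" .
qed

lemma mem_if_monomials_mem:
  fixes p :: "'a \<Rightarrow>\<^sub>0 'b::comm_monoid_add"
  assumes "0 \<in> J" "\<And>p q. p \<in> J \<Longrightarrow> q \<in> J \<Longrightarrow> p + q \<in> J"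
    and "\<And>m. m \<in> keys p \<Longrightarrow> single m (lu p m) \<in> J"
  shows "p \<in> J"
proof -
  have "(\<Sum>m\<in>A. single m (lu p m)) \<in> J" if "A \<subseteq> keys p" for A
    using finite_subset[OF that finite_keys] that
    by (induction A rule: finite_induct) (simp_all add: assms)
  then show ?thesis using sum_monomials[of p] by (metis order_refl)
qed

lemma monomial_ideal_mult:
  assumes "p \<in> monomial_ideal U" "q \<in> monomial_ideal V"
  shows "p * q \<in> monomial_ideal (sumset U V)"
  using assms keys_mult[of p q] unfolding monomial_ideal_def sumset_def by blast

lemma monomial_ideal_add:
  "p \<in> monomial_ideal U \<Longrightarrow> q \<in> monomial_ideal U \<Longrightarrow> p + q \<in> monomial_ideal U"
  using Poly_Mapping.keys_add[of p q] unfolding monomial_ideal_def by blast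

lemma zero_in_monomial_ideal: "0 \<in> monomial_ideal U"
  by (simp add: monomial_ideal_def)

lemma sumset_exps: "upset E U \<Longrightarrow> sumset U (exps E) \<subseteq> U" "upset E U \<Longrightarrow> sumset (exps E) U \<subseteq> U"
  by (auto simp: upset_def sumset_def) (metis add.commute)

lemma a_inv_poly_ring:
  assumes "p \<in> carrier (poly_ring E)"
  shows "\<ominus>\<^bsub>poly_ring E\<^esub> p = - (p :: ('e, 'k::field) mpoly)"
proof -
  interpret cring "poly_ring E :: ('e, 'k) mpoly ring" by (rule cring_poly_ring)
  show ?thesis using assms by (intro minus_equality) (simp_all add: monomial_ideal_def)
qed

lemma ideal_monomial_ideal:
  assumes U: "upset E U"
  shows "ideal (monomial_ideal U) (poly_ring E :: ('e, 'k::field) mpoly ring)"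
proof (rule idealI)
  let ?R = "poly_ring E :: ('e, 'k) mpoly ring"
  interpret cring ?R by (rule cring_poly_ring)
  show "ring ?R" by (rule ring_axioms)
  have sub: "monomial_ideal U \<subseteq> carrier ?R" using upset_subset[OF U] by (simp add: monomial_ideal_mono)
  show "subgroup (monomial_ideal U) (add_monoid ?R)"
  proof (rule add.subgroupI)
    show "monomial_ideal U \<noteq> ({} :: ('e, 'k) mpoly set)" using zero_in_monomial_ideal by blast
  next
    fix p :: "('e, 'k) mpoly" assume p: "p \<in> monomial_ideal U"
    then have "\<ominus>\<^bsub>?R\<^esub> p = - p" using sub by (intro a_inv_poly_ring) blast
    then show "\<ominus>\<^bsub>?R\<^esub> p \<in> monomial_ideal U"
      using p by (simp add: monomial_ideal_def)
  qed (use sub monomial_ideal_add in auto)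
  fix p x :: "('e, 'k) mpoly" assume "p \<in> monomial_ideal U" "x \<in> carrier ?R"
  then show "x \<otimes>\<^bsub>?R\<^esub> p \<in> monomial_ideal U" "p \<otimes>\<^bsub>?R\<^esub> x \<in> monomial_ideal U"
    using monomial_ideal_mult sumset_exps[OF U] monomial_ideal_mono by (simp_all, blast+)
qed

text \<open>Each term of a polynomial on the right is itself a product, its coefficient being put on
  the first factor, and \<open>ideal_prod\<close> is closed under sums.\<close>

lemma ideal_prod_monomial_ideal:
  "ideal_prod (poly_ring E) (monomial_ideal U) (monomial_ideal V)
     = (monomial_ideal (sumset U V) :: ('e, 'k::field) mpoly set)"
proof
  let ?P = "ideal_prod (poly_ring E) (monomial_ideal U) (monomial_ideal V) :: ('e, 'k) mpoly set"
  show "?P \<subseteq> monomial_ideal (sumset U V)"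
  proof
    fix p assume "p \<in> ?P"
    then show "p \<in> monomial_ideal (sumset U V)"
      by induction (simp_all add: monomial_ideal_mult monomial_ideal_add)
  qed
  show "monomial_ideal (sumset U V) \<subseteq> ?P"
  proof
    fix p :: "('e, 'k) mpoly" assume p: "p \<in> monomial_ideal (sumset U V)"
    have add: "p + q \<in> ?P" if "p \<in> ?P" "q \<in> ?P" for p q
      using ideal_prod.sum[OF that] by simp
    have mult: "p * q \<in> ?P" if "p \<in> monomial_ideal U" "q \<in> monomial_ideal V" for p q
      using ideal_prod.prod[OF that, of "poly_ring E"] by simp
    show "p \<in> ?P"
    proof (rule mem_if_monomials_mem)
      show "0 \<in> ?P" using mult[OF zero_in_monomial_ideal zero_in_monomial_ideal] by simp
      fix m assume "m \<in> keys p"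
      then obtain a b where ab: "m = a + b" "a \<in> U" "b \<in> V"
        using p by (auto simp: monomial_ideal_def sumset_def)
      then have "single m (lu p m) = single a (lu p m) * single b 1" by (simp add: mult_single)
      then show "single m (lu p m) \<in> ?P" using mult ab single_in_monomial_ideal by metis
    qed (rule add)
  qed
qed

text \<open>The recursion starts at \<open>exps E\<close> because the zeroth power of an ideal is
  the whole ring.\<close>

primrec nfold :: "'e set \<Rightarrow> ('e \<Rightarrow>\<^sub>0 nat) set \<Rightarrow> nat \<Rightarrow> ('e \<Rightarrow>\<^sub>0 nat) set" where
  "nfold E U 0 = exps E"
| "nfold E U (Suc q) = sumset (nfold E U q) U"

lemma ideal_power_monomial_ideal:
  "ideal_power (poly_ring E) (monomial_ideal U) q
     = (monomial_ideal (nfold E U q) :: ('e, 'k::field) mpoly set)"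
proof (induction q)
  case 0
  show ?case by (simp add: nat_pow_def ideals_set_def)
next
  case (Suc q)
  then show ?case by (simp add: nat_pow_def ideals_set_def ideal_prod_monomial_ideal)
qed

section \<open>Ideals generated by squarefree monomials, and their degrees\<close>

definition indicator_exp :: "'e set \<Rightarrow> 'e \<Rightarrow>\<^sub>0 nat" where
  "indicator_exp B = (\<Sum>i\<in>B. single i 1)"

lemma lookup_indicator_exp:
  "finite B \<Longrightarrow> lu (indicator_exp B) i = (if i \<in> B then 1 else 0)"
  by (simp add: indicator_exp_def lookup_sum lookup_single when_def)

lemma keys_indicator_exp: "finite B \<Longrightarrow> keys (indicator_exp B) = B"
  by (auto simp: in_keys_iff lookup_indicator_exp split: if_splits)

lemma sqfree_monom_eq: "finite B \<Longrightarrow> sqfree_monom B = single (indicator_exp B) (1 :: 'k::field)"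
  by (induction B rule: finite_induct)
    (auto simp: sqfree_monom_def indicator_exp_def var_def mult_single)

text \<open>Subtraction of exponents is truncated; \<open>B \<subseteq> keys m\<close> makes it
  exact.\<close>

lemma split_off_indicator:
  assumes "finite B" "B \<subseteq> keys m"
  shows "m = (m - indicator_exp B) + indicator_exp B"
  using assms by (intro poly_mapping_eqI)
    (auto simp: lookup_add lookup_minus lookup_indicator_exp in_keys_iff subset_iff Suc_leI)

lemma exps_diff: "m \<in> exps E \<Longrightarrow> m - n \<in> exps E"
  by (auto simp: exps_def in_keys_iff lookup_minus subset_iff)

lemma genideal_sqfree:
  assumes H: "\<And>B. B \<in> H \<Longrightarrow> B \<subseteq> E" and fin: "finite E"
  shows "Idl\<^bsub>poly_ring E\<^esub> (sqfree_monom ` H) = (monomial_ideal (supported E H) :: ('e, 'k::field) mpoly set)"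
proof
  let ?R = "poly_ring E :: ('e, 'k) mpoly ring"
  interpret cring ?R by (rule cring_poly_ring)
  have finB: "finite B" if "B \<in> H" for B using H[OF that] fin finite_subset by blast
  have ind: "indicator_exp B \<in> supported E H" if "B \<in> H" for B
    using that H[OF that] keys_indicator_exp[OF finB[OF that]] by (auto simp: supported_def exps_def)
  have mem: "sqfree_monom ` H \<subseteq> (monomial_ideal (supported E H) :: ('e, 'k) mpoly set)"
  proof (rule image_subsetI)
    fix B assume B: "B \<in> H"
    show "sqfree_monom B \<in> (monomial_ideal (supported E H) :: ('e, 'k) mpoly set)"
      unfolding sqfree_monom_eq[OF finB[OF B]] by (rule single_in_monomial_ideal[OF ind[OF B]])
  qed
  show "Idl\<^bsub>?R\<^esub> (sqfree_monom ` H) \<subseteq> monomial_ideal (supported E H)"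
    by (rule genideal_minimal[OF ideal_monomial_ideal[OF upset_supported] mem])
  have carr: "sqfree_monom ` H \<subseteq> carrier ?R"
    using mem monomial_ideal_mono[of "supported E H" "exps E", where 'b = 'k]
      upset_subset[OF upset_supported[of E H]] by simp
  interpret I: ideal "Idl\<^bsub>?R\<^esub> (sqfree_monom ` H)" ?R by (rule genideal_ideal[OF carr])
  show "monomial_ideal (supported E H) \<subseteq> Idl\<^bsub>?R\<^esub> (sqfree_monom ` H)"
  proof
    fix p :: "('e, 'k) mpoly" assume p: "p \<in> monomial_ideal (supported E H)"
    show "p \<in> Idl\<^bsub>?R\<^esub> (sqfree_monom ` H)"
    proof (rule mem_if_monomials_mem)
      show "0 \<in> Idl\<^bsub>?R\<^esub> (sqfree_monom ` H)" using I.zero_closed by simp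
      show "q + r \<in> Idl\<^bsub>?R\<^esub> (sqfree_monom ` H)"
        if "q \<in> Idl\<^bsub>?R\<^esub> (sqfree_monom ` H)" "r \<in> Idl\<^bsub>?R\<^esub> (sqfree_monom ` H)" for q r
        using I.a_closed[OF that] by simp
      fix m assume "m \<in> keys p"
      then have "m \<in> supported E H" using p by (auto simp: monomial_ideal_def)
      then obtain B where B: "B \<in> H" "B \<subseteq> keys m" "m \<in> exps E" by (auto simp: supported_def)
      have "sqfree_monom B \<in> Idl\<^bsub>?R\<^esub> (sqfree_monom ` H)" using genideal_self[OF carr] B(1) by blast
      moreover have "single (m - indicator_exp B) (lu p m) \<in> carrier ?R"
        using B(3) by (simp add: single_in_monomial_ideal exps_diff)
      ultimately have "single (m - indicator_exp B) (lu p m) * sqfree_monom B \<in> Idl\<^bsub>?R\<^esub> (sqfree_monom ` H)"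
        using I.I_l_closed by simp
      moreover have "single (m - indicator_exp B) (lu p m) * sqfree_monom B = single m (lu p m)"
        using split_off_indicator[OF finB[OF B(1)] B(2), symmetric]
        by (simp add: mult_single sqfree_monom_eq finB[OF B(1)])
      ultimately show "single m (lu p m) \<in> Idl\<^bsub>?R\<^esub> (sqfree_monom ` H)" by simp
    qed
  qed
qed

text \<open>Any monomial of a nonzero homogeneous element lies in the ideal and has the same
  degree.\<close>

lemma initial_degree_monomial_ideal:
  "initial_degree (monomial_ideal U :: ('e, 'k::field) mpoly set) = (LEAST d. \<exists>m\<in>U. monom_degree m = d)"
proof -
  have "(\<exists>p\<in>monomial_ideal U. p \<noteq> (0 :: ('e, 'k) mpoly) \<and> homogeneous d p) \<longleftrightarrow> (\<exists>m\<in>U. monom_degree m = d)" for d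
  proof
    assume "\<exists>p\<in>monomial_ideal U. p \<noteq> (0 :: ('e, 'k) mpoly) \<and> homogeneous d p"
    then obtain p where p: "p \<in> monomial_ideal U" "p \<noteq> (0 :: ('e, 'k) mpoly)" "homogeneous d p" by blast
    obtain m where "m \<in> keys p" using p(2) by (metis keys_eq_empty ex_in_conv)
    then show "\<exists>m\<in>U. monom_degree m = d" using p by (auto simp: monomial_ideal_def homogeneous_def)
  next
    assume "\<exists>m\<in>U. monom_degree m = d"
    then obtain m where m: "m \<in> U" "monom_degree m = d" by blast
    have "(single m 1 :: ('e, 'k) mpoly) \<noteq> 0" by (metis keys_single keys_zero insert_not_empty zero_neq_one)
    then show "\<exists>p\<in>monomial_ideal U. p \<noteq> (0 :: ('e, 'k) mpoly) \<and> homogeneous d p"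
      using m single_in_monomial_ideal[of m U 1] by (intro bexI[of _ "single m 1"]) (auto simp: homogeneous_def)
  qed
  then show ?thesis by (simp add: initial_degree_def)
qed

lemma monom_degree_eq:
  assumes "finite E" "m \<in> exps E"
  shows "monom_degree m = (\<Sum>i\<in>E. lu m i)"
  unfolding monom_degree_def using assms
  by (intro sum.mono_neutral_left) (auto simp: exps_def in_keys_iff)

section \<open>Symbolic powers of squarefree monomial ideals\<close>

text \<open>Positional notation: the new variable gets a weight \<open>D\<close> above all sums
  attained so far, so that division by \<open>D\<close> recovers its exponent and the old sum. On
  finitely many monomials such a weight serves as an additive monomial order.\<close>

lemma weight_separating:
  assumes "finite E" "finite (A :: ('e \<Rightarrow> nat) set)"
  shows "\<exists>w :: 'e \<Rightarrow> nat. \<forall>a\<in>A. \<forall>b\<in>A. (\<Sum>e\<in>E. w e * a e) = (\<Sum>e\<in>E. w e * b e) \<longrightarrow> (\<forall>e\<in>E. a e = b e)"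
  using assms(1)
proof (induction E)
  case empty
  show ?case by simp
next
  case (insert x E)
  obtain w :: "'e \<Rightarrow> nat" where w: "\<And>a b. a \<in> A \<Longrightarrow> b \<in> A \<Longrightarrow>
    (\<Sum>e\<in>E. w e * a e) = (\<Sum>e\<in>E. w e * b e) \<Longrightarrow> \<forall>e\<in>E. a e = b e"
    using insert.IH by blast
  define W where "W a = (\<Sum>e\<in>E. w e * a e)" for a :: "'e \<Rightarrow> nat"
  define D where "D = Suc (Max (W ` A))"
  have D: "W a < D" if "a \<in> A" for a using that assms(2) by (simp add: D_def less_Suc_eq_le)
  have eq: "(\<Sum>e\<in>insert x E. (w(x := D)) e * a e) = D * a x + W a" for a
  proof -
    have "(\<Sum>e\<in>E. (w(x := D)) e * a e) = W a"
      unfolding W_def using insert.hyps by (intro sum.cong) auto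
    then show ?thesis using insert.hyps by simp
  qed
  show ?case
  proof (intro exI[of _ "w(x := D)"] ballI impI)
    fix a b e assume ab: "a \<in> A" "b \<in> A" and e: "e \<in> insert x E"
      and "(\<Sum>e\<in>insert x E. (w(x := D)) e * a e) = (\<Sum>e\<in>insert x E. (w(x := D)) e * b e)"
    then have *: "D * a x + W a = D * b x + W b" by (simp only: eq)
    have "(D * a x + W a) div D = a x" "(D * a x + W a) mod D = W a"
      "(D * b x + W b) div D = b x" "(D * b x + W b) mod D = W b"
      using D[OF ab(1)] D[OF ab(2)] by simp_all
    then have "a x = b x" "W a = W b" using * by metis+
    then show "a e = b e" using w[OF ab] e by (auto simp: W_def)
  qed
qed

lemma lookup_mult_sum:
  "lu (p * q) m = (\<Sum>a\<in>keys p. \<Sum>b\<in>keys q. if m = a + b then lu p a * lu q b else 0)"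
proof -
  have "p * q = (\<Sum>a\<in>keys p. single a (lu p a)) * (\<Sum>b\<in>keys q. single b (lu q b))"
    by (simp only: sum_monomials)
  also have "\<dots> = (\<Sum>a\<in>keys p. \<Sum>b\<in>keys q. single (a + b) (lu p a * lu q b))"
    by (simp add: sum_product mult_single)
  finally show ?thesis
    by (simp add: lookup_sum lookup_single when_def eq_commute)
qed

text \<open>Primality: among the monomials of \<open>p\<close> and of \<open>q\<close> that avoid \<open>C\<close>, the ones of maximal weight
  contribute a monomial to \<open>p * q\<close> that cannot cancel.\<close>

lemma primeideal_meeting:
  assumes fin: "finite E"
  shows "primeideal (monomial_ideal (meeting E C)) (poly_ring E :: ('e, 'k::field) mpoly ring)"
proof -
  let ?R = "poly_ring E :: ('e, 'k) mpoly ring"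
  let ?P = "monomial_ideal (meeting E C) :: ('e, 'k) mpoly set"
  show ?thesis
  proof (rule primeidealI[OF ideal_monomial_ideal[OF upset_meeting] cring_poly_ring])
    have "(0 :: 'e \<Rightarrow>\<^sub>0 nat) \<notin> meeting E C" by (simp add: meeting_def)
    then have "\<not> exps E \<subseteq> meeting E C" using exps_zero by blast
    then show "carrier ?R \<noteq> ?P" using monomial_ideal_mono[of "exps E" "meeting E C"] by auto
  next
    fix p q assume carr: "p \<in> carrier ?R" "q \<in> carrier ?R" and prod: "p \<otimes>\<^bsub>?R\<^esub> q \<in> ?P"
    show "p \<in> ?P \<or> q \<in> ?P"
    proof (rule ccontr)
      assume neg: "\<not> (p \<in> ?P \<or> q \<in> ?P)"
      define A where "A r = {m \<in> keys r. keys m \<inter> C = {}}" for r :: "('e, 'k) mpoly"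
      have keysE: "m \<in> exps E" if "m \<in> keys p \<union> keys q" for m
        using that carr by (auto simp: monomial_ideal_def)
      have ne: "A p \<noteq> {}" "A q \<noteq> {}"
        using neg keysE by (auto simp: A_def monomial_ideal_def meeting_def)
      have finA: "finite (A r)" for r by (simp add: A_def)
      obtain w :: "'e \<Rightarrow> nat" where w: "\<And>a b. a \<in> lu ` (A p \<union> A q) \<Longrightarrow> b \<in> lu ` (A p \<union> A q) \<Longrightarrow>
          (\<Sum>e\<in>E. w e * a e) = (\<Sum>e\<in>E. w e * b e) \<Longrightarrow> \<forall>e\<in>E. a e = b e"
        using weight_separating[OF fin, of "lu ` (A p \<union> A q)"] finA by blast
      define W where "W m = (\<Sum>e\<in>E. w e * lu m e)" for m :: "'e \<Rightarrow>\<^sub>0 nat"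
      have Wadd: "W (a + b) = W a + W b" for a b
        by (simp add: W_def lookup_add algebra_simps sum.distrib)
      have inj: "a = b" if ab: "a \<in> A p \<union> A q" "b \<in> A p \<union> A q" and "W a = W b" for a b
      proof (rule poly_mapping_eqI)
        fix e
        have "a \<in> exps E" "b \<in> exps E" using ab keysE by (auto simp: A_def)
        then have "lu a e = 0" "lu b e = 0" if "e \<notin> E"
          using that by (auto simp: exps_def in_keys_iff)
        moreover have "lu a e = lu b e" if "e \<in> E"
          using w[of "lu a" "lu b"] ab \<open>W a = W b\<close> that by (auto simp: W_def)
        ultimately show "lu a e = lu b e" by metis
      qed
      have max: "\<exists>a\<in>A r. \<forall>x\<in>A r. W x \<le> W a" if "A r \<noteq> {}" for r
      proof -
        have "Max (W ` A r) \<in> W ` A r" using that finA by (intro Max_in) auto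
        then obtain a where "a \<in> A r" "Max (W ` A r) = W a" by blast
        then show ?thesis using finA Max_ge[of "W ` A r"] by (metis finite_imageI imageI)
      qed
      obtain a where a: "a \<in> A p" "\<And>x. x \<in> A p \<Longrightarrow> W x \<le> W a" using max[OF ne(1)] by blast
      obtain b where b: "b \<in> A q" "\<And>x. x \<in> A q \<Longrightarrow> W x \<le> W b" using max[OF ne(2)] by blast
      \<comment> \<open>Exponents cannot cancel, so both summands of a vector avoiding
        \<open>C\<close> avoid \<open>C\<close> as well. Maximality of \<open>W a\<close> and
        \<open>W b\<close> and additivity of \<open>W\<close> then leave only one
        decomposition.\<close>
      have uniq: "x = a \<and> y = b" if xy: "x \<in> keys p" "y \<in> keys q" "a + b = x + y" for x y
      proof -
        have "keys (a + b) \<inter> C = {}" using a(1) b(1) by (auto simp: A_def keys_add_nat)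
        then have "keys x \<inter> C = {}" "keys y \<inter> C = {}" using xy(3) by (auto simp: keys_add_nat)
        then have A: "x \<in> A p" "y \<in> A q" using xy by (auto simp: A_def)
        have "W a + W b = W x + W y" using xy(3) Wadd by metis
        then have "W x = W a" "W y = W b" using a(2)[OF A(1)] b(2)[OF A(2)] by linarith+
        then show ?thesis using inj A a(1) b(1) by blast
      qed
      have "lu (p * q) (a + b) = (\<Sum>x\<in>keys p. \<Sum>y\<in>keys q. if x = a \<and> y = b then lu p a * lu q b else 0)"
        unfolding lookup_mult_sum using uniq by (intro sum.cong refl) auto
      also have "\<dots> = (\<Sum>x\<in>keys p. if x = a then lu p a * lu q b else 0)"
        using b(1) by (intro sum.cong refl) (auto simp: A_def)
      also have "\<dots> = lu p a * lu q b" using a(1) by (auto simp: A_def)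
      also have "\<dots> \<noteq> 0" using a(1) b(1) by (auto simp: A_def)
      finally have "a + b \<in> keys (p * q)" by (simp add: in_keys_iff)
      then have "a + b \<in> meeting E C" using prod by (auto simp: monomial_ideal_def)
      then show False using a(1) b(1) by (auto simp: meeting_def A_def keys_add_nat)
    qed
  qed
qed

section \<open>Minimal primes of squarefree monomial ideals\<close>

lemma var_in_poly_ring: "i \<in> E \<Longrightarrow> var i \<in> carrier (poly_ring E)"
  by (simp add: var_def monomial_ideal_def exps_def)

lemma primeideal_sqfree_monom:
  fixes Q :: "('e, 'k::field) mpoly set"
  assumes Q: "primeideal Q (poly_ring E)" and B: "finite B" "B \<subseteq> E" "sqfree_monom B \<in> Q"
  shows "\<exists>i\<in>B. var i \<in> Q"
  using B
proof (induction B)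
  case empty
  interpret primeideal Q "poly_ring E" by fact
  have "\<one>\<^bsub>poly_ring E\<^esub> \<in> Q" using empty by (simp add: sqfree_monom_def)
  then have "Q = carrier (poly_ring E)" by (rule one_imp_carrier)
  then show ?case using I_notcarr by simp
next
  case (insert x B)
  interpret primeideal Q "poly_ring E" by fact
  have "(sqfree_monom B :: ('e, 'k) mpoly) \<in> carrier (poly_ring E)"
    using insert.prems(1) insert.hyps(1)
    by (simp add: sqfree_monom_eq monomial_ideal_def exps_def keys_indicator_exp)
  moreover have "var x \<otimes>\<^bsub>poly_ring E\<^esub> sqfree_monom B \<in> Q"
    using insert.prems(2) insert.hyps by (simp add: sqfree_monom_def)
  ultimately have "var x \<in> Q \<or> sqfree_monom B \<in> Q"
    using I_prime var_in_poly_ring[of x E] insert.prems(1) by blast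
  then show ?case using insert by auto
qed

lemma meeting_subset_ideal:
  fixes Q :: "('e, 'k::field) mpoly set"
  assumes Q: "ideal Q (poly_ring E)" and T: "\<And>i. i \<in> T \<Longrightarrow> var i \<in> Q"
  shows "monomial_ideal (meeting E T) \<subseteq> Q"
proof
  fix p :: "('e, 'k) mpoly" assume p: "p \<in> monomial_ideal (meeting E T)"
  interpret ideal Q "poly_ring E" by fact
  show "p \<in> Q"
  proof (rule mem_if_monomials_mem)
    show "0 \<in> Q"
      using additive_subgroup.zero_closed[OF ideal.axioms(1)[OF Q]] by simp
    show "q + r \<in> Q" if "q \<in> Q" "r \<in> Q" for q r
      using additive_subgroup.a_closed[OF ideal.axioms(1)[OF Q] that] by simp
    fix m assume "m \<in> keys p"
    then have "m \<in> meeting E T" using p by (auto simp: monomial_ideal_def)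
    then obtain i where i: "i \<in> keys m" "i \<in> T" "m \<in> exps E" by (auto simp: meeting_def)
    have "single (m - single i 1) (lu p m) \<in> carrier (poly_ring E)"
      using i(3) by (simp add: single_in_monomial_ideal exps_diff)
    then have "single (m - single i 1) (lu p m) * var i \<in> Q"
      using I_l_closed[OF T[OF i(2)]] by simp
    moreover have "m - single i 1 + single i 1 = m"
      using split_off_indicator[of "{i}" m] i(1) by (simp add: indicator_exp_def)
    ultimately show "single m (lu p m) \<in> Q" by (simp add: var_def mult_single)
  qed
qed

lemma var_in_meeting: "var i \<in> (monomial_ideal (meeting E C) :: ('e, 'k::field) mpoly set) \<longleftrightarrow> i \<in> E \<inter> C"
  by (auto simp: var_def monomial_ideal_def meeting_def exps_def)

text \<open>The variables in a prime \<open>Q\<close> above the ideal form a transversal, and the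
  prime generated by them lies below \<open>Q\<close>. Hence minimality among primes reduces to
  minimality among sets of variables.\<close>

lemma minimal_primes_supported:
  assumes H: "\<And>B. B \<in> H \<Longrightarrow> B \<subseteq> E" and fin: "finite E"
  shows "minimal_primes (poly_ring E :: ('e, 'k::field) mpoly ring) (monomial_ideal (supported E H))
    = (\<lambda>C. monomial_ideal (meeting E C)) ` min_transversals E H"
proof -
  let ?R = "poly_ring E :: ('e, 'k) mpoly ring"
  let ?I = "monomial_ideal (supported E H) :: ('e, 'k) mpoly set"
  let ?P = "\<lambda>C. monomial_ideal (meeting E C) :: ('e, 'k) mpoly set"
  have finB: "finite B" if "B \<in> H" for B using H[OF that] fin finite_subset by blast
  have sub: "?I \<subseteq> ?P C" if "transversal H C" for C
    unfolding monomial_ideal_mono using that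
    by (fastforce simp: supported_def meeting_def transversal_def)
  have tr: "transversal H {i\<in>E. var i \<in> Q}" if Q: "primeideal Q ?R" "?I \<subseteq> Q" for Q
    unfolding transversal_def
  proof
    fix B assume B: "B \<in> H"
    have "indicator_exp B \<in> supported E H"
      using B H[OF B] keys_indicator_exp[OF finB[OF B]] by (auto simp: supported_def exps_def)
    then have "single (indicator_exp B) 1 \<in> ?I" by (rule single_in_monomial_ideal)
    then have "sqfree_monom B \<in> Q"
      unfolding sqfree_monom_eq[OF finB[OF B]] using Q(2) by blast
    then show "B \<inter> {i\<in>E. var i \<in> Q} \<noteq> {}"
      using primeideal_sqfree_monom[OF Q(1) finB[OF B] H[OF B]] H[OF B] by blast
  qed
  have below: "?P T \<subseteq> Q" if "primeideal Q ?R" "T \<subseteq> {i\<in>E. var i \<in> Q}" for Q T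
    using that by (intro meeting_subset_ideal primeideal.axioms(1)) auto
  show ?thesis
  proof
    show "minimal_primes ?R ?I \<subseteq> ?P ` min_transversals E H"
    proof
      fix Q assume "Q \<in> minimal_primes ?R ?I"
      then have Q: "primeideal Q ?R" "?I \<subseteq> Q"
        and min: "\<And>Q'. primeideal Q' ?R \<Longrightarrow> ?I \<subseteq> Q' \<Longrightarrow> Q' \<subseteq> Q \<Longrightarrow> Q' = Q"
        by (auto simp: minimal_primes_def)
      obtain C where C: "C \<in> min_transversals E H" "C \<subseteq> {i\<in>E. var i \<in> Q}"
        using min_transversal_exists[OF _ _ tr[OF Q], of E] fin by auto
      have "?P C = Q"
        using C(1) by (intro min primeideal_meeting fin sub below Q C) (auto simp: min_transversals_def)
      then show "Q \<in> ?P ` min_transversals E H" using C by blast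
    qed
    show "?P ` min_transversals E H \<subseteq> minimal_primes ?R ?I"
    proof
      fix P assume "P \<in> ?P ` min_transversals E H"
      then obtain C where C: "C \<in> min_transversals E H" and P: "P = ?P C" by blast
      have "Q = P" if Q: "primeideal Q ?R" "?I \<subseteq> Q" "Q \<subseteq> P" for Q
      proof -
        have "{i\<in>E. var i \<in> Q} \<subseteq> C" using Q(3) var_in_meeting[of _ E C] unfolding P by blast
        then have "C = {i\<in>E. var i \<in> Q}" using tr[OF Q(1,2)] C by (auto simp: min_transversals_def)
        then show ?thesis using below[OF Q(1), of C] Q(3) unfolding P by blast
      qed
      then show "P \<in> minimal_primes ?R ?I"
        using C sub[of C] primeideal_meeting[OF fin, of C]
        by (auto simp: minimal_primes_def P min_transversals_def)
    qed
  qed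
qed

section \<open>Symbolic powers as sets of exponents\<close>

lemma nfold_meeting:
  assumes C: "C \<subseteq> E" and fin: "finite E"
  shows "nfold E (meeting E C) s = {m \<in> exps E. s \<le> (\<Sum>i\<in>C. lu m i)}"
proof (induction s)
  case 0
  show ?case by simp
next
  case (Suc s)
  have finC: "finite C" using C fin finite_subset by blast
  show ?case
  proof
    show "nfold E (meeting E C) (Suc s) \<subseteq> {m \<in> exps E. Suc s \<le> (\<Sum>i\<in>C. lu m i)}"
    proof
      fix m assume "m \<in> nfold E (meeting E C) (Suc s)"
      then obtain a b where m: "m = a + b" "a \<in> exps E" "s \<le> (\<Sum>i\<in>C. lu a i)" "b \<in> meeting E C"
        by (auto simp: Suc sumset_def)
      obtain i where i: "i \<in> keys b" "i \<in> C" using m(4) by (auto simp: meeting_def)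
      have "lu b i \<le> (\<Sum>i\<in>C. lu b i)" using i finC by (intro member_le_sum) auto
      then have "1 \<le> (\<Sum>i\<in>C. lu b i)" using i(1) by (simp add: in_keys_iff)
      then show "m \<in> {m \<in> exps E. Suc s \<le> (\<Sum>i\<in>C. lu m i)}"
        using m by (auto simp: meeting_def lookup_add sum.distrib)
    qed
    show "{m \<in> exps E. Suc s \<le> (\<Sum>i\<in>C. lu m i)} \<subseteq> nfold E (meeting E C) (Suc s)"
    proof
      fix m assume m: "m \<in> {m \<in> exps E. Suc s \<le> (\<Sum>i\<in>C. lu m i)}"
      then have "(\<Sum>i\<in>C. lu m i) \<noteq> 0" by auto
      then obtain i where i: "i \<in> C" "lu m i \<noteq> 0" by (meson sum.neutral)
      have split: "m = (m - single i 1) + single i 1"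
        using split_off_indicator[of "{i}" m] i(2) by (simp add: indicator_exp_def in_keys_iff)
      have "(\<Sum>j\<in>C. lu m j) = (\<Sum>j\<in>C. lu (m - single i 1) j) + (\<Sum>j\<in>C. lu (single i 1) j)"
        by (subst split) (simp add: lookup_add sum.distrib)
      also have "(\<Sum>j\<in>C. lu (single i 1) j) = (1::nat)"
        using i finC by (simp add: lookup_single when_def)
      finally have "s \<le> (\<Sum>j\<in>C. lu (m - single i 1) j)" using m by simp
      then have "m - single i 1 \<in> nfold E (meeting E C) s"
        using m exps_diff by (auto simp: Suc)
      moreover have "single i 1 \<in> meeting E C" using i C by (auto simp: meeting_def exps_def)
      ultimately show "m \<in> nfold E (meeting E C) (Suc s)"
        using split by (auto simp: sumset_def)
    qed
  qed
qed

definition symbolic_exps :: "'e set \<Rightarrow> 'e set set \<Rightarrow> nat \<Rightarrow> ('e \<Rightarrow>\<^sub>0 nat) set" where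
  "symbolic_exps E H s = {m \<in> exps E. \<forall>C\<in>min_transversals E H. s \<le> (\<Sum>i\<in>C. lu m i)}"

lemma symbolic_power_supported:
  assumes H: "\<And>B. B \<in> H \<Longrightarrow> B \<subseteq> E" and fin: "finite E"
  shows "symbolic_power (poly_ring E) (monomial_ideal (supported E H)) s
    = (monomial_ideal (symbolic_exps E H s) :: ('e, 'k::field) mpoly set)"
proof -
  have sub: "C \<subseteq> E" if "C \<in> min_transversals E H" for C
    using that by (auto simp: min_transversals_def)
  have "symbolic_power (poly_ring E) (monomial_ideal (supported E H)) s
    = monomial_ideal (exps E) \<inter> (\<Inter>C\<in>min_transversals E H.
        (ideal_power (poly_ring E) (monomial_ideal (meeting E C)) s :: ('e, 'k) mpoly set))"
    unfolding symbolic_power_def by (simp add: minimal_primes_supported H fin)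
  also have "\<dots> = monomial_ideal (exps E) \<inter> (\<Inter>C\<in>min_transversals E H.
        monomial_ideal {m \<in> exps E. s \<le> (\<Sum>i\<in>C. lu m i)})"
    using sub by (simp add: ideal_power_monomial_ideal nfold_meeting fin)
  also have "\<dots> = monomial_ideal (symbolic_exps E H s)"
    by (auto simp: monomial_ideal_def symbolic_exps_def)
  finally show ?thesis .
qed

section \<open>Waldschmidt constant and asymptotic resurgence\<close>

text \<open>The packing describes a product of at least \<open>q\<close> generators dividing
  \<open>x^m\<close>; one generator is split off at a time.\<close>

lemma packing_in_nfold:
  assumes fin: "finite E" "finite H" and sub: "\<And>B. B \<in> H \<Longrightarrow> B \<subseteq> E"
    and "m \<in> exps E" "q \<le> sum c H" "\<And>e. e \<in> E \<Longrightarrow> load H c e \<le> lu m e"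
  shows "m \<in> nfold E (supported E H) q"
  using assms(4-6)
proof (induction q arbitrary: m c)
  case 0
  then show ?case by simp
next
  case (Suc q)
  have "sum c H \<noteq> 0" using Suc.prems(2) by simp
  then obtain B where B: "B \<in> H" "c B \<noteq> 0" by (meson sum.neutral)
  have BE: "B \<subseteq> E" "finite B" using sub[OF B(1)] fin(1) finite_subset by auto
  define c' where "c' = c(B := c B - 1)"
  have c: "c = c'(B := Suc (c' B))" using B(2) by (auto simp: c'_def)
  have load: "load H c e = load H c' e + (if e \<in> B then 1 else 0)" for e
    by (subst c) (rule load_upd[OF fin(2) B(1)])
  have "sum c H = Suc (sum c' H)"
    by (subst c) (rule sum_upd_Suc[OF fin(2) B(1)])
  then have q: "q \<le> sum c' H" using Suc.prems(2) by simp
  have "B \<subseteq> keys m"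
  proof
    fix e assume e: "e \<in> B"
    then have "1 \<le> load H c e" using load by simp
    then show "e \<in> keys m" using Suc.prems(3)[of e] e BE by (auto simp: in_keys_iff)
  qed
  then have split: "m = (m - indicator_exp B) + indicator_exp B"
    using split_off_indicator BE by blast
  have "m - indicator_exp B \<in> nfold E (supported E H) q"
  proof (rule Suc.IH[OF _ q])
    show "m - indicator_exp B \<in> exps E" using Suc.prems(1) exps_diff by blast
    show "load H c' e \<le> lu (m - indicator_exp B) e" if "e \<in> E" for e
      using Suc.prems(3)[OF that] load[of e] BE by (auto simp: lookup_minus lookup_indicator_exp)
  qed
  moreover have "indicator_exp B \<in> supported E H"
    using B BE by (auto simp: supported_def exps_def keys_indicator_exp)
  ultimately show ?case using split by (auto simp: sumset_def)
qed

text \<open>What bases and cocircuits have in common, so that both ideals are treated at once: the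
  roles of \<open>H\<close> and its minimal transversals, and with them \<open>b\<close> and
  \<open>c\<close>, are exchanged in the second instance. \<open>L\<close> is the set of nonloops in
  both.\<close>

locale uniform_blocking_pair =
  fixes E L :: "'e set" and H :: "'e set set" and b c :: nat
  assumes finite_E: "finite E"
    and H_nonempty: "H \<noteq> {}"
    and L_subset: "L \<subseteq> E" "L \<noteq> {}"
    and H_subset: "\<And>B. B \<in> H \<Longrightarrow> B \<subseteq> L"
    and T_subset: "\<And>C. C \<in> min_transversals E H \<Longrightarrow> C \<subseteq> L"
    and card_H: "\<And>B. B \<in> H \<Longrightarrow> card B = b"
    and card_T: "\<And>C. C \<in> min_transversals E H \<Longrightarrow> card C = c"
    and pos: "0 < b" "0 < c"
    and blocking_inequality: "\<And>(w :: 'e \<Rightarrow> real) y u v. (\<And>e. 0 \<le> w e) \<Longrightarrow> (\<And>e. 0 \<le> y e) \<Longrightarrow>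
      0 \<le> u \<Longrightarrow> 0 \<le> v \<Longrightarrow> (\<And>B. B \<in> H \<Longrightarrow> u \<le> sum w B) \<Longrightarrow>
      (\<And>C. C \<in> min_transversals E H \<Longrightarrow> v \<le> sum y C) \<Longrightarrow>
      u * v * real (card L) \<le> real b * real c * (\<Sum>e\<in>E. w e * y e)"
begin

lemma finite_L: "finite L"
  using L_subset finite_E finite_subset by blast

lemma H_subset_E: "B \<in> H \<Longrightarrow> B \<subseteq> E"
  using H_subset L_subset by blast

lemma finite_H: "finite H" "B \<in> H \<Longrightarrow> finite B"
  using H_subset_E finite_E finite_subset[of H "Pow E"] finite_subset[of B E] by auto

lemma card_L: "0 < card L"
  using L_subset finite_L by (simp add: card_gt_0_iff)

lemma supported_degree:
  assumes "m \<in> supported E H"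
  shows "b \<le> (\<Sum>i\<in>E. lu m i)"
proof -
  obtain B where B: "B \<in> H" "B \<subseteq> keys m" using assms by (auto simp: supported_def)
  have "b = (\<Sum>i\<in>B. 1)" using card_H[OF B(1)] by simp
  also have "\<dots> \<le> (\<Sum>i\<in>B. lu m i)"
    using B(2) by (intro sum_mono) (auto simp: in_keys_iff subset_iff Suc_leI)
  also have "\<dots> \<le> (\<Sum>i\<in>E. lu m i)"
    using H_subset_E[OF B(1)] finite_E by (intro sum_mono2) auto
  finally show ?thesis .
qed

lemma nfold_degree: "m \<in> nfold E (supported E H) q \<Longrightarrow> q * b \<le> (\<Sum>i\<in>E. lu m i)"
proof (induction q arbitrary: m)
  case (Suc q)
  then obtain a a' where m: "m = a + a'" "a \<in> nfold E (supported E H) q" "a' \<in> supported E H"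
    by (auto simp: sumset_def)
  show ?case using Suc.IH[OF m(2)] supported_degree[OF m(3)]
    by (simp add: m(1) lookup_add sum.distrib)
qed simp

lemma initial_degree_supported:
  "initial_degree (monomial_ideal (supported E H) :: ('e, 'k::field) mpoly set) = b"
  unfolding initial_degree_monomial_ideal
proof (rule Least_equality)
  obtain B where B: "B \<in> H" using H_nonempty by blast
  have ind: "indicator_exp B \<in> supported E H"
    using B H_subset_E[OF B] finite_H(2)[OF B] by (auto simp: supported_def exps_def keys_indicator_exp)
  have "monom_degree (indicator_exp B) = card B"
    using finite_H(2)[OF B] by (simp add: monom_degree_def keys_indicator_exp lookup_indicator_exp)
  then show "\<exists>m\<in>supported E H. monom_degree m = b" using ind card_H[OF B] by auto
next
  fix d assume "\<exists>m\<in>supported E H. monom_degree m = d"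
  then obtain m where m: "m \<in> supported E H" "monom_degree m = d" by blast
  have "m \<in> exps E" using m(1) by (simp add: supported_def)
  then show "b \<le> d" using supported_degree[OF m(1)] m(2) monom_degree_eq[OF finite_E] by simp
qed

text \<open>The case \<open>w = 1\<close> of the inequality, where every member of \<open>H\<close>
  has weight \<open>b\<close>.\<close>

lemma symbolic_degree:
  assumes m: "m \<in> symbolic_exps E H s"
  shows "real s * real (card L) \<le> real c * real (\<Sum>i\<in>E. lu m i)"
proof -
  have "real b * real s * real (card L) \<le> real b * real c * (\<Sum>e\<in>E. 1 * real (lu m e))"
  proof (rule blocking_inequality)
    show "real s \<le> (\<Sum>e\<in>C. real (lu m e))" if "C \<in> min_transversals E H" for C
    proof -
      have "s \<le> (\<Sum>e\<in>C. lu m e)" using m that by (simp add: symbolic_exps_def)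
      then have "real s \<le> real (\<Sum>e\<in>C. lu m e)" by (rule of_nat_mono)
      then show ?thesis by simp
    qed
  qed (simp_all add: card_H)
  then have "real b * (real s * real (card L)) \<le> real b * (real c * real (\<Sum>i\<in>E. lu m i))" by (simp add: mult.assoc)
  then show ?thesis using pos(1) by (subst (asm) mult_le_cancel_left_pos) auto
qed

text \<open>The exponent is constant on \<open>L\<close>, with a value just large enough that
  \<open>c\<close> times it reaches \<open>s\<close>; rounding overshoots by at most
  \<open>c\<close>, which explains the term \<open>s + c\<close>.\<close>

lemma symbolic_witness:
  "\<exists>m\<in>symbolic_exps E H s. c * (\<Sum>i\<in>E. lu m i) \<le> (s + c) * card L"
proof -
  define t where "t = Suc (s div c)"
  define m where "m = (\<Sum>i\<in>L. single i t)"
  have lum: "lu m i = (if i \<in> L then t else 0)" for i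
    using finite_L by (simp add: m_def lookup_sum lookup_single when_def)
  have "t * c = c + s div c * c" by (simp add: t_def)
  then have t: "s \<le> t * c" "t * c \<le> s + c"
    using div_mult_mod_eq[of s c] mod_less_divisor[OF pos(2), of s] by linarith+
  have "(\<Sum>i\<in>C. lu m i) = t * c" if C: "C \<in> min_transversals E H" for C
  proof -
    have "(\<Sum>i\<in>C. lu m i) = (\<Sum>i\<in>C. t)" using T_subset[OF C] by (intro sum.cong) (auto simp: lum)
    then show ?thesis using card_T[OF C] by simp
  qed
  moreover have "m \<in> exps E"
    using L_subset by (auto simp: exps_def in_keys_iff lum split: if_splits)
  ultimately have "m \<in> symbolic_exps E H s" using t(1) by (simp add: symbolic_exps_def)
  moreover have "(\<Sum>i\<in>E. lu m i) = t * card L"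
  proof -
    have "(\<Sum>i\<in>E. lu m i) = (\<Sum>i\<in>L. lu m i)"
      using L_subset finite_E by (intro sum.mono_neutral_right) (auto simp: lum)
    then show ?thesis by (simp add: lum)
  qed
  moreover have "c * (t * card L) \<le> (s + c) * card L"
    using mult_right_mono[OF t(2), of "card L"] by (simp add: mult_ac)
  ultimately show ?thesis by metis
qed

lemma initial_degree_symbolic:
  fixes s :: nat
  defines "a \<equiv> initial_degree (monomial_ideal (symbolic_exps E H s) :: ('e, 'k::field) mpoly set)"
  shows "real s * real (card L) \<le> real c * real a" "real c * real a \<le> (real s + real c) * real (card L)"
proof -
  have exps: "m \<in> exps E" if "m \<in> symbolic_exps E H s" for m using that by (simp add: symbolic_exps_def)
  have a: "a = (LEAST d. \<exists>m\<in>symbolic_exps E H s. monom_degree m = d)"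
    unfolding a_def by (rule initial_degree_monomial_ideal)
  obtain m where m: "m \<in> symbolic_exps E H s" "c * (\<Sum>i\<in>E. lu m i) \<le> (s + c) * card L"
    using symbolic_witness by blast
  have "\<exists>m'\<in>symbolic_exps E H s. monom_degree m' = a"
    unfolding a by (rule LeastI_ex) (use m in blast)
  then show "real s * real (card L) \<le> real c * real a"
    using symbolic_degree monom_degree_eq[OF finite_E exps] by metis
  have "a \<le> monom_degree m" unfolding a by (rule Least_le) (use m in blast)
  then have "c * a \<le> c * (\<Sum>i\<in>E. lu m i)" using monom_degree_eq[OF finite_E exps[OF m(1)]] by simp
  then have "real (c * a) \<le> real ((s + c) * card L)" using m(2) by linarith
  then show "real c * real a \<le> (real s + real c) * real (card L)" by simp
qed

lemma waldschmidt_supported: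
  "waldschmidt (poly_ring E) (monomial_ideal (supported E H) :: ('e, 'k::field) mpoly set)
     = real (card L) / real c"
proof -
  define a where "a s = real (initial_degree (monomial_ideal (symbolic_exps E H s) :: ('e, 'k) mpoly set))" for s
  have lower: "real (card L) / real c \<le> a s / real s" if "0 < s" for s
    using initial_degree_symbolic(1)[of s, where 'k = 'k] that pos(2) unfolding a_def
    by (simp add: divide_simps mult_ac)
  have upper: "a s / real s \<le> real (card L) / real c + real (card L) / real s" if "0 < s" for s
    using initial_degree_symbolic(2)[of s, where 'k = 'k] that pos(2) unfolding a_def
    by (simp add: divide_simps algebra_simps)
  have "(\<lambda>s. a s / real s) \<longlonglongrightarrow> real (card L) / real c"
  proof (rule tendsto_sandwich)
    show "\<forall>\<^sub>F s in sequentially. real (card L) / real c \<le> a s / real s"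
      using eventually_gt_at_top[of 0] by eventually_elim (rule lower)
    show "\<forall>\<^sub>F s in sequentially. a s / real s \<le> real (card L) / real c + real (card L) / real s"
      using eventually_gt_at_top[of 0] by eventually_elim (rule upper)
    show "(\<lambda>s. real (card L) / real c + real (card L) / real s) \<longlonglongrightarrow> real (card L) / real c"
      using tendsto_add[OF tendsto_const lim_const_over_n] by simp
  qed (rule tendsto_const)
  then show ?thesis
    by (simp add: waldschmidt_def symbolic_power_supported H_subset_E finite_E a_def limI)
qed

text \<open>Exponents in the symbolic power \<open>s * t\<close> admit fractional packings of size
  \<open>K * t\<close>, and \<open>r < K\<close>. The slack \<open>(K - r) * t\<close> grows with
  \<open>t\<close> and absorbs the loss from passing to an integral packing.\<close>

lemma eventually_contained:
  assumes "real r * (real b * real c) < real s * real (card L)"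
  shows "\<forall>\<^sub>F t in sequentially. symbolic_exps E H (s * t) \<subseteq> nfold E (supported E H) (r * t)"
proof -
  define K where "K = real s * real (card L) / (real b * real c)"
  have bc: "0 < real b * real c" using pos by simp
  have K: "real r < K" using assms bc by (simp add: K_def pos_less_divide_eq)
  \<comment> \<open>Chosen so that \<open>\<theta> * K\<close> is the midpoint of \<open>r\<close>
    and \<open>K\<close>: one half of the slack goes into the factor \<open>\<theta>\<close>, the
    other half covers the rounding loss \<open>card H\<close> once \<open>t\<close> is
    large.\<close>
  define \<theta> where "\<theta> = (1 + real r / K) / 2"
  have Kpos: "0 < K" using K by linarith
  then have "0 \<le> real r / K" "real r / K < 1" using K by simp_all
  then have \<theta>: "0 < \<theta>" "\<theta> < 1" by (simp_all add: \<theta>_def add_pos_nonneg)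
  have \<theta>K: "\<theta> * K = (K + real r) / 2" using Kpos by (simp add: \<theta>_def field_simps)
  have "\<forall>\<^sub>F t in sequentially. 2 * real (card H) / (K - real r) \<le> real t"
    using filterlim_real_sequentially unfolding filterlim_at_top by blast
  then show ?thesis
    using eventually_gt_at_top[of 0]
  proof eventually_elim
    fix t :: nat assume t: "2 * real (card H) / (K - real r) \<le> real t" "0 < t"
    show "symbolic_exps E H (s * t) \<subseteq> nfold E (supported E H) (r * t)"
    proof
      fix m assume m: "m \<in> symbolic_exps E H (s * t)"
      have "\<exists>B\<in>H. (K * real t) * sum w B \<le> (\<Sum>e\<in>E. w e * real (lu m e))"
        if w: "\<And>e. 0 \<le> w e" for w :: "'e \<Rightarrow> real"
      proof -
        \<comment> \<open>The lightest member of \<open>H\<close> supplies the bound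
          \<open>u\<close> of the blocking inequality, which thereby becomes the selection rule for
          packings.\<close>
        have "Min (sum w ` H) \<in> sum w ` H" using finite_H H_nonempty by (intro Min_in) auto
        then obtain B where B: "B \<in> H" "Min (sum w ` H) = sum w B" by blast
        have min: "sum w B \<le> sum w A" if "A \<in> H" for A
          using that finite_H(1) unfolding B(2)[symmetric] by (intro Min_le) auto
        have "sum w B * real (s * t) * real (card L) \<le> real b * real c * (\<Sum>e\<in>E. w e * real (lu m e))"
        proof (rule blocking_inequality)
          show "0 \<le> sum w B" using w by (intro sum_nonneg) auto
          show "real (s * t) \<le> (\<Sum>e\<in>C. real (lu m e))" if "C \<in> min_transversals E H" for C
          proof -
            have "s * t \<le> (\<Sum>e\<in>C. lu m e)" using m that by (simp add: symbolic_exps_def)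
            then have "real (s * t) \<le> real (\<Sum>e\<in>C. lu m e)" by (rule of_nat_mono)
            then show ?thesis by simp
          qed
        qed (use w min in auto)
        then have "(real b * real c) * ((K * real t) * sum w B) \<le> (real b * real c) * (\<Sum>e\<in>E. w e * real (lu m e))"
          using pos by (simp add: K_def mult_ac)
        then have "(K * real t) * sum w B \<le> (\<Sum>e\<in>E. w e * real (lu m e))"
          using bc by (rule mult_left_le_imp_le)
        then show ?thesis using B(1) by blast
      qed
      then obtain f :: "'e set \<Rightarrow> nat" where f: "\<theta> * (K * real t) - real (card H) \<le> real (sum f H)"
        "\<And>e. e \<in> E \<Longrightarrow> load H f e \<le> lu m e"
        using integral_packing[OF finite_E finite_H(1) H_subset_E, of "K * real t" \<theta> "lu m"] \<theta> Kpos t(2)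
        by auto
      have "2 * real (card H) \<le> real t * (K - real r)"
        using t(1) K by (simp add: pos_divide_le_eq)
      moreover have "\<theta> * (K * real t) = (K + real r) / 2 * real t" using \<theta>K by (simp only: mult.assoc[symmetric])
      ultimately have "real r * real t \<le> \<theta> * (K * real t) - real (card H)"
        by (simp add: field_simps)
      then have "real (r * t) \<le> real (sum f H)" using f(1) by simp
      then have "r * t \<le> sum f H" by (simp only: of_nat_le_iff)
      moreover have "m \<in> exps E" using m by (simp add: symbolic_exps_def)
      ultimately show "m \<in> nfold E (supported E H) (r * t)"
        using packing_in_nfold[OF finite_E finite_H(1) H_subset_E] f(2) by blast
    qed
  qed
qed

text \<open>A comparison of degrees: the nearly constant cost of rounding in
  \<open>symbolic_witness\<close> is eventually outweighed by the gap \<open>D * t\<close> between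
  the degrees, both scaled by \<open>c\<close>.\<close>

lemma eventually_not_contained:
  assumes "real s * real (card L) < real r * (real b * real c)"
  shows "\<forall>\<^sub>F t in sequentially. \<not> symbolic_exps E H (s * t) \<subseteq> nfold E (supported E H) (r * t)"
proof -
  define D where "D = real r * (real b * real c) - real s * real (card L)"
  have D: "0 < D" using assms by (simp add: D_def)
  have "\<forall>\<^sub>F t in sequentially. real c * real (card L) / D < real t"
    using filterlim_real_sequentially unfolding filterlim_at_top_dense by blast
  then show ?thesis
  proof eventually_elim
    fix t :: nat assume t: "real c * real (card L) / D < real t"
    obtain m where m: "m \<in> symbolic_exps E H (s * t)" "c * (\<Sum>i\<in>E. lu m i) \<le> (s * t + c) * card L"
      using symbolic_witness by blast
    have "m \<notin> nfold E (supported E H) (r * t)"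
    proof
      assume "m \<in> nfold E (supported E H) (r * t)"
      then have "c * (r * t * b) \<le> c * (\<Sum>i\<in>E. lu m i)" using nfold_degree by simp
      then have "c * (r * t * b) \<le> (s * t + c) * card L" using m(2) by linarith
      then have "real (c * (r * t * b)) \<le> real ((s * t + c) * card L)" by (rule of_nat_mono)
      then have "real t * D \<le> real c * real (card L)" by (simp add: D_def algebra_simps)
      then show False using t D by (simp add: pos_divide_less_eq)
    qed
    then show "\<not> symbolic_exps E H (s * t) \<subseteq> nfold E (supported E H) (r * t)" using m(1) by blast
  qed
qed

text \<open>Every ratio \<open>s / r\<close> below the constant belongs to the set and every ratio
  above it does not; the supremum is the same whatever happens at equality.\<close>

lemma asymptotic_resurgence_supported:
  "asymptotic_resurgence (poly_ring E) (monomial_ideal (supported E H) :: ('e, 'k::field) mpoly set)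
     = real b * real c / real (card L)"
proof -
  let ?rho = "real b * real c / real (card L)"
  define X where "X = {real s / real r | s r. 0 < s \<and> 0 < r \<and>
    (\<forall>\<^sub>F t in sequentially. \<not> symbolic_exps E H (s * t) \<subseteq> nfold E (supported E H) (r * t))}"
  have N: "0 < real (card L)" using card_L by simp
  have rho: "0 < ?rho" using pos N by simp
  have below: "\<exists>x\<in>X. z < x" if z: "z < ?rho" for z
  proof -
    \<comment> \<open>The maximum with \<open>0\<close> keeps \<open>q\<close> positive, so that its
      numerator is a legitimate \<open>s\<close>.\<close>
    obtain q where q: "q \<in> \<rat>" "max z 0 < q" "q < ?rho"
      using Rats_dense_in_real[of "max z 0" ?rho] z rho by auto
    obtain s r :: nat where sr: "r \<noteq> 0" "\<bar>q\<bar> = real s / real r"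
      using Rats_abs_nat_div_natE[OF q(1)] by metis
    then have qsr: "q = real s / real r" using q(2) by simp
    have "0 < s" using q(2) qsr by (cases s) auto
    moreover have "real s * real (card L) < real r * (real b * real c)"
      using q(3) sr(1) N unfolding qsr by (simp add: divide_simps mult_ac split: if_splits)
    ultimately have "q \<in> X"
      unfolding X_def using eventually_not_contained sr(1) qsr by blast
    then show ?thesis using q(2) by auto
  qed
  have above: "x \<le> ?rho" if X: "x \<in> X" for x
  proof (rule ccontr)
    assume neg: "\<not> x \<le> ?rho"
    obtain s r where x: "x = real s / real r" "0 < r"
      and ev: "\<forall>\<^sub>F t in sequentially. \<not> symbolic_exps E H (s * t) \<subseteq> nfold E (supported E H) (r * t)"
      using X unfolding X_def by blast
    have "real r * (real b * real c) < real s * real (card L)"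
      using neg x N by (simp add: divide_simps mult_ac not_le split: if_splits)
    then have "\<forall>\<^sub>F t in sequentially. symbolic_exps E H (s * t) \<subseteq> nfold E (supported E H) (r * t)"
      by (rule eventually_contained)
    with ev have "\<forall>\<^sub>F t :: nat in sequentially. False" by eventually_elim simp
    then show False by simp
  qed
  have "Sup X = ?rho"
  proof (rule cSup_eq_non_empty)
    show "X \<noteq> {}" using below[OF rho] by blast
    show "?rho \<le> z" if "\<And>x. x \<in> X \<Longrightarrow> x \<le> z" for z
      using below[of z] that by (meson leD leI)
  qed (rule above)
  then show ?thesis
    by (simp add: asymptotic_resurgence_def symbolic_power_supported H_subset_E finite_E
      ideal_power_monomial_ideal monomial_ideal_mono X_def)
qed

end

section \<open>Bases and cocircuits of perfect matroid designs\<close>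

lemma perfect_matroid_design_card_cl:
  assumes pmd: "perfect_matroid_design M" and IJ: "indep M I" "indep M J" "card I = card J"
  shows "card (cl M I) = card (cl M J)"
proof -
  interpret matroid_bases M
    by unfold_locales (use pmd in \<open>simp add: perfect_matroid_design_def\<close>)
  show ?thesis
  \<comment> \<open>The definition of a design speaks of ranks from \<open>1\<close> on; in rank
    \<open>0\<close> both sets are empty.\<close>
  proof (cases "card I = 0")
    case True
    then have "I = J" using IJ indep_finite by simp
    then show ?thesis by simp
  next
    case False
    obtain B where B: "B \<in> bases M" using bases_nonempty by blast
    have "card I \<in> {1..rk M}"
      using False card_base_indep[OF IJ(1) B] rank_ground[OF B] by simp
    moreover have "flat M (cl M I)" "flat M (cl M J)" using flat_cl IJ by auto
    moreover have "rank_of M (cl M I) = card I" "rank_of M (cl M J) = card I"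
      using rank_cl IJ by simp_all
    ultimately show ?thesis using pmd unfolding perfect_matroid_design_def by blast
  qed
qed

text \<open>Cocircuits are complements of hyperplanes, which all have rank \<open>rk M - 1\<close>
  and hence the same size; \<open>d\<close> is the size of any one of them.\<close>

lemma perfect_design_exists:
  assumes pmd: "perfect_matroid_design M" and "1 \<le> rk M"
  shows "\<exists>d. perfect_design M (rk M) d"
proof -
  interpret matroid_bases M
    by unfold_locales (use pmd in \<open>simp add: perfect_matroid_design_def\<close>)
  let ?T = "min_transversals (ground M) (bases M)"
  have cardB: "card B = rk M" if "B \<in> bases M" for B using rank_ground that by simp
  have "{} \<notin> bases M" using cardB assms(2) by fastforce
  then obtain C where C: "C \<in> ?T" using min_transversals_nonempty by blast
  have eq: "card D = card C" if D: "D \<in> ?T" for D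
  proof -
    obtain I where I: "indep M I" "\<forall>B\<in>bases M. Suc (card I) = card B" "C = ground M - cl M I"
      using min_transversal_hyperplane[OF C] by blast
    obtain J where J: "indep M J" "\<forall>B\<in>bases M. Suc (card J) = card B" "D = ground M - cl M J"
      using min_transversal_hyperplane[OF D] by blast
    have "card I = card J" using I(2) J(2) bases_nonempty by fastforce
    then have "card (cl M I) = card (cl M J)" using perfect_matroid_design_card_cl pmd I J by blast
    then show ?thesis using I(3) J(3) cl_ground finite_cl by (simp add: card_Diff_subset)
  qed
  have "C \<noteq> {}" using C bases_nonempty by (auto simp: min_transversals_def transversal_def)
  moreover have "finite C" using C finite_ground finite_subset by (auto simp: min_transversals_def)
  ultimately have "0 < card C" by (simp add: card_gt_0_iff)
  have "perfect_design M (rk M) (card C)"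
  proof unfold_locales
    show "card (cl M I) = card (cl M J)" if "indep M I" "indep M J" "card I = card J" for I J
      by (rule perfect_matroid_design_card_cl[OF pmd that])
    show "0 < rk M" using assms(2) by linarith
  qed (fact cardB eq \<open>0 < card C\<close>)+
  then show ?thesis by blast
qed

context perfect_design
begin

text \<open>Bases have equal cardinality and thus form an antichain, to which blocker duality
  applies.\<close>

lemma min_transversals_cocircuits:
  "min_transversals (ground M) (min_transversals (ground M) (bases M)) = bases M"
proof (rule min_transversals_involution[OF finite_ground base_subset])
  fix A B assume AB: "A \<in> bases M" "B \<in> bases M" "A \<subseteq> B"
  then show "A = B" using card_subset_eq[OF finite_base] card_base by metis
qed

lemma cocircuit_subset:
  assumes C: "C \<in> min_transversals (ground M) (bases M)"
  shows "C \<subseteq> ground M - loops M"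
proof
  fix x assume x: "x \<in> C"
  have "\<not> transversal (bases M) (C - {x})" using C x by (auto simp: min_transversals_def)
  moreover have "transversal (bases M) C" using C by (simp add: min_transversals_def)
  ultimately obtain B where "B \<in> bases M" "x \<in> B" by (auto simp: transversal_def)
  then show "x \<in> ground M - loops M" using base_subset by (auto simp: loops_def)
qed

lemma base_subset_nonloops: "B \<in> bases M \<Longrightarrow> B \<subseteq> ground M - loops M"
  using base_subset by (auto simp: loops_def)

lemma nonloops_nonempty: "ground M - loops M \<noteq> {}"
proof -
  obtain B where B: "B \<in> bases M" using bases_nonempty by blast
  then have "B \<noteq> {}" using card_base rank_pos by fastforce
  then show ?thesis using base_subset_nonloops[OF B] by blast
qed

lemma blocking_pair_bases:
  "uniform_blocking_pair (ground M) (ground M - loops M) (bases M) k d"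
proof unfold_locales
  fix w y :: "'a \<Rightarrow> real" and u v :: real
  assume "\<And>e. 0 \<le> w e" "\<And>e. 0 \<le> y e" "0 \<le> u" "0 \<le> v" "\<And>B. B \<in> bases M \<Longrightarrow> u \<le> sum w B"
    "\<And>C. C \<in> min_transversals (ground M) (bases M) \<Longrightarrow> v \<le> sum y C"
  then show "u * v * real (card (ground M - loops M)) \<le> real k * real d * (\<Sum>e\<in>ground M. w e * y e)"
    by (intro base_cocircuit_inequality) auto
qed (use finite_ground bases_nonempty nonloops_nonempty base_subset_nonloops cocircuit_subset
    card_base card_cocircuit rank_pos d_pos in auto)

text \<open>The bases are now the transversals, so the inequality is used with \<open>w\<close> and
  \<open>y\<close>, as well as \<open>u\<close> and \<open>v\<close>, interchanged.\<close>

lemma blocking_pair_cocircuits: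
  "uniform_blocking_pair (ground M) (ground M - loops M) (min_transversals (ground M) (bases M)) d k"
proof (unfold_locales, unfold min_transversals_cocircuits)
  fix w y :: "'a \<Rightarrow> real" and u v :: real
  assume "\<And>e. 0 \<le> w e" "\<And>e. 0 \<le> y e" "0 \<le> u" "0 \<le> v"
    "\<And>C. C \<in> min_transversals (ground M) (bases M) \<Longrightarrow> u \<le> sum w C"
    "\<And>B. B \<in> bases M \<Longrightarrow> v \<le> sum y B"
  then have "v * u * real (card (ground M - loops M)) \<le> real k * real d * (\<Sum>e\<in>ground M. y e * w e)"
    by (intro base_cocircuit_inequality) auto
  then show "u * v * real (card (ground M - loops M)) \<le> real d * real k * (\<Sum>e\<in>ground M. w e * y e)"
    by (simp add: mult_ac)
next
  have "{} \<notin> bases M" using card_base rank_pos by fastforce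
  then show "min_transversals (ground M) (bases M) \<noteq> {}" by (rule min_transversals_nonempty)
qed (use finite_ground nonloops_nonempty base_subset_nonloops cocircuit_subset
    card_base card_cocircuit rank_pos d_pos in auto)

end

theorem theorem6p3:
  fixes M :: "'e base_system" and n k :: nat
    and S :: "('e, 'k::field) mpoly ring"
  assumes "perfect_matroid_design M"
    and "rk M = k" and "card (ground M) = n"
    and "1 \<le> k" and "k < n"
    and "S = poly_ring (ground M)"
  shows "asymptotic_resurgence S (facet_ideal S M)
           = real (initial_degree (facet_ideal S M)) / waldschmidt S (facet_ideal S M)
       \<and> real (initial_degree (facet_ideal S M)) / waldschmidt S (facet_ideal S M)
           = real k * real (initial_degree (stanley_reisner_ideal S (dual M)))
               / (real n - real (card (loops M)))
       \<and> real k * real (initial_degree (stanley_reisner_ideal S (dual M)))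
               / (real n - real (card (loops M)))
           = real (initial_degree (stanley_reisner_ideal S (dual M)))
               / waldschmidt S (stanley_reisner_ideal S (dual M))
       \<and> real (initial_degree (stanley_reisner_ideal S (dual M)))
               / waldschmidt S (stanley_reisner_ideal S (dual M))
           = asymptotic_resurgence S (stanley_reisner_ideal S (dual M))"
proof -
  obtain d where "perfect_design M k d" using perfect_design_exists[OF assms(1)] assms(2,4) by blast
  then interpret perfect_design M k d .
  let ?T = "min_transversals (ground M) (bases M)"
  interpret bas: uniform_blocking_pair "ground M" "ground M - loops M" "bases M" k d
    by (rule blocking_pair_bases)
  interpret coc: uniform_blocking_pair "ground M" "ground M - loops M" ?T d k
    by (rule blocking_pair_cocircuits)
  have facet: "facet_ideal S M = monomial_ideal (supported (ground M) (bases M))"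
    unfolding facet_ideal_def assms(6) by (rule genideal_sqfree[OF base_subset finite_ground])
  have sr: "stanley_reisner_ideal S (dual M) = monomial_ideal (supported (ground M) ?T)"
    unfolding stanley_reisner_ideal_def assms(6) circuits_dual
    by (rule genideal_sqfree[OF coc.H_subset_E finite_ground])
  have "loops M \<subseteq> ground M" by (auto simp: loops_def)
  then have N: "real (card (ground M - loops M)) = real n - real (card (loops M))"
    using assms(3) finite_ground finite_subset[of "loops M" "ground M"]
      card_mono[OF finite_ground, of "loops M"]
    by (simp add: card_Diff_subset of_nat_diff)
  \<comment> \<open>With \<open>N\<close> nonloops the Waldschmidt constants are
    \<open>N / d\<close> and \<open>N / k\<close> and the initial degrees \<open>k\<close> and
    \<open>d\<close>, so all five expressions equal \<open>k * d / N\<close>.\<close>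
  show ?thesis
    unfolding facet sr
    unfolding assms(6) bas.asymptotic_resurgence_supported coc.asymptotic_resurgence_supported
      bas.initial_degree_supported coc.initial_degree_supported
      bas.waldschmidt_supported coc.waldschmidt_supported N
    by (simp add: mult.commute)
qed

end
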